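(* Let $f,\varphi,\psi\in\mathcal{F}^{\ast}$ and $a,b\in\mathcal{F}_1\cup\mathcal{F}^{\ast}$. Then there are uniquely determined sequences of constants $(c_n)_{n\ge0}$ and $(d_n)_{n\ge0}$ in $\mathbb{K}$ such that $f(x)=\sum_{n\ge0}\frac{c_n}{n!}a(x)\varphi(x)^n$ and $\bar f(x)=\sum_{n\ge0}\frac{d_n}{n!}b(x)\psi(x)^n$, where $\bar f$ is the compositional inverse of $f$. Moreover $d_n=\Lambda_n(a,\varphi\,|\,b,\psi)(c_0,c_1,\ldots)$ and $c_n=\Lambda_n(b,\psi\,|\,a,\varphi)(d_0,d_1,\ldots)$, or equivalently $\Lambda_n(a,\varphi\,|\,b,\psi)\circ\Lambda_{\bullet}(b,\psi\,|\,a,\varphi)=X_n$ for every $n\ge1$.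
   Context: $\mathbb{K}$ is a field of characteristic zero, $\mathcal{F}=\mathbb{K}[[x]]$ with derivation $D$; $\mathcal{F}_1$ is the set of series with nonzero constant term, $\mathcal{F}^{\ast}$ the set of series $g$ with $g(0)=0$, $D(g)(0)\ne0$. Partial Bell polynomials: $B_{0,0}=1$, $B_{n,0}=0$ ($n\ge1$), $B_{n,k}=0$ ($k>n$), and for $1\le k\le n$, $B_{n,k}=\sum\frac{n!}{\prod_i r_i!(i!)^{r_i}}\prod_i X_i^{r_i}$ over non-negative integers $r_i$ with $\sum r_i=k$, $\sum ir_i=n$. $A_{n,k}$ is the unique lower triangular family with $A_{0,0}=1$, $A_{n,0}=0$ ($n\ge1$) and $\sum_{j=k}^nA_{n,j}B_{j,k}=\delta_{nk}$ ($0\le k\le n$); they lie in $\mathbb{K}[X_1^{-1},X_1,X_2,\ldots]$. For a polynomial $P$ and a function $\varphi$, $P^{\varphi}(0)$ means $P$ with each $X_j$ replaced by $D^j(\varphi)(0)$. The reciprocal polynomials are $\widehat R_n:=\sum_{k=0}^n(-1)^kk!\,X_0^{-(k+1)}B_{n,k}$. For $a\in\mathcal{F}$ write $a_j=D^j(a)(0)$. For $\varphi\in\mathcal{F}_0$ define $\Gamma_n(a,\varphi):=\sum_{k=0}^n\big(\sum_{j=k}^n\binom{n}{j}a_{n-j}B^{\varphi}_{j,k}(0)\big)X_k$. If $a\in\mathcal{F}_1$ put $\Gamma^{(1)}_n(a,\varphi):=\Gamma_n(a,\varphi)(0,X_1,\ldots,X_n)$ (i.e. $X_0:=0$) and $\bar\Gamma^{(1)}_n(a,\varphi):=\sum_{k=0}^n\big(\sum_{j=k}^n\binom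 jk\widehat R_{j-k}(a_0,\ldots,a_{j-k})A^{\varphi}_{n,j}(0)\big)X_k$; if $a\in\mathcal{F}^{\ast}$ put $\Gamma^{(2)}_n(a,\varphi):=\Gamma_n(a,\varphi)$ and $\bar\Gamma^{(2)}_n(a,\varphi):=\sum_{k=0}^n\frac1{k+1}\big(\sum_{j=k}^n\binom jk\widehat R_{j-k}(\tfrac{a_1}{1},\ldots,\tfrac{a_{j-k+1}}{j-k+1})A^{\varphi}_{n,j}(0)\big)X_{k+1}$. $\Gamma_n$ and $\bar\Gamma_n$ denote the version $(1)$ or $(2)$ according as the first argument lies in $\mathcal{F}_1$ or $\mathcal{F}^{\ast}$. Then $\Lambda_n(a,\varphi\,|\,b,\psi):=\bar\Gamma_n(b,\psi)\circ A_{\bullet,1}\circ\Gamma_{\bullet}(a,\varphi)$, meaning: in $\bar\Gamma_n(b,\psi)$ each $X_j$ is replaced by $A_{j,1}(\Gamma_1(a,\varphi),\ldots,\Gamma_j(a,\varphi))$ (with $A_{0,1}=0$). In general, $P\circ Q_{\bullet}$ denotes replacing each $X_j$ in $P$ by $Q_j$, and $P(c_0,c_1,\ldots)$ denotes evaluation at $X_j=c_j$. *)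

theory Defs
  imports
    "HOL-Library.Poly_Mapping"
    "HOL-Computational_Algebra.Fraction_Field"
    "HOL-Computational_Algebra.Formal_Power_Series"
begin

text \<open>
  All the (Laurent) polynomials below are elements of the field \<open>\<bbbK>(X\<^sub>0, X\<^sub>1, \<dots>)\<close>, the fraction
  field of \<open>\<bbbK>[X\<^sub>0, X\<^sub>1, \<dots>]\<close>. A polynomial maps exponent vectors to coefficients.
\<close>

type_synonym 'a mpol = "(nat \<Rightarrow>\<^sub>0 nat) \<Rightarrow>\<^sub>0 'a"
type_synonym 'a ratfun = "'a mpol fract"

definition rconst :: "'a::field \<Rightarrow> 'a ratfun" where
  "rconst c = Fraction_Field.Fract (Poly_Mapping.single 0 c) 1"

definition rvar :: "nat \<Rightarrow> 'a::field ratfun" where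
  "rvar j = Fraction_Field.Fract (Poly_Mapping.single (Poly_Mapping.single j 1) 1) 1"

definition mpol_insert :: "('a::field \<Rightarrow> 'b::field) \<Rightarrow> (nat \<Rightarrow> 'b) \<Rightarrow> 'a mpol \<Rightarrow> 'b" where
  "mpol_insert \<iota> v p =
     (\<Sum>m\<in>Poly_Mapping.keys p. \<iota> (Poly_Mapping.lookup p m) *
        (\<Prod>i\<in>Poly_Mapping.keys m. v i ^ Poly_Mapping.lookup m i))"

text \<open>
  The value of a rational function at a point \<open>v\<close> with coordinates in an extension field
  \<open>\<iota> : \<bbbK> \<rightarrow> L\<close>. It exists iff some representation as a fraction has a denominator not vanishing
  at \<open>v\<close>, and is then independent of the representation (see \<open>ratfun_insert_Fract\<close> below);
  otherwise it is left unspecified.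
\<close>

definition ratfun_insert :: "('a::field \<Rightarrow> 'b::field) \<Rightarrow> (nat \<Rightarrow> 'b) \<Rightarrow> 'a ratfun \<Rightarrow> 'b" where
  "ratfun_insert \<iota> v P =
     (THE y. \<exists>p q. P = Fraction_Field.Fract p q \<and> mpol_insert \<iota> v q \<noteq> 0 \<and>
                   y = mpol_insert \<iota> v p / mpol_insert \<iota> v q)"

definition reval :: "'a::field ratfun \<Rightarrow> (nat \<Rightarrow> 'a) \<Rightarrow> 'a" where
  "reval P c = ratfun_insert (\<lambda>x. x) c P"

definition rsubst :: "'a::field ratfun \<Rightarrow> (nat \<Rightarrow> 'a ratfun) \<Rightarrow> 'a ratfun" (infixl "\<circ>\<^sub>R" 55) where
  "P \<circ>\<^sub>R Q = ratfun_insert rconst Q P"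

text \<open>\<open>r\<^sub>i > 0\<close> forces \<open>i \<le> n\<close>, so only the indices \<open>1, \<dots>, n\<close> matter.\<close>

definition bell_types :: "nat \<Rightarrow> nat \<Rightarrow> (nat \<Rightarrow> nat) set" where
  "bell_types n k = {r. (\<forall>i. i \<notin> {1..n} \<longrightarrow> r i = 0) \<and>
                        (\<Sum>i=1..n. r i) = k \<and> (\<Sum>i=1..n. i * r i) = n}"

definition bell_B :: "nat \<Rightarrow> nat \<Rightarrow> 'a::field_char_0 ratfun" where
  "bell_B n k =
     (if k = 0 then (if n = 0 then 1 else 0)
      else if k > n then 0
      else (\<Sum>r\<in>bell_types n k.
              rconst (fact n / (\<Prod>i=1..n. fact (r i) * fact i ^ r i)) *
              (\<Prod>i=1..n. rvar i ^ r i)))"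

definition is_bell_inverse :: "(nat \<Rightarrow> nat \<Rightarrow> 'a::field_char_0 ratfun) \<Rightarrow> bool" where
  "is_bell_inverse A \<longleftrightarrow>
     (\<forall>n k. k > n \<longrightarrow> A n k = 0) \<and> A 0 0 = 1 \<and> (\<forall>n\<ge>1. A n 0 = 0) \<and>
     (\<forall>n k. k \<le> n \<longrightarrow> (\<Sum>j=k..n. A n j * bell_B j k) = (if n = k then 1 else 0))"

definition bell_A :: "nat \<Rightarrow> nat \<Rightarrow> 'a::field_char_0 ratfun" where
  "bell_A = (THE A. is_bell_inverse A)"

definition recip_R :: "nat \<Rightarrow> 'a::field_char_0 ratfun" where
  "recip_R n = (\<Sum>k\<le>n. rconst ((-1) ^ k * fact k) * inverse (rvar 0 ^ (k + 1)) * bell_B n k)"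

definition fps_F1 :: "'a::field fps set" where
  "fps_F1 = {g. fps_nth g 0 \<noteq> 0}"

definition fps_Fstar :: "'a::field fps set" where
  "fps_Fstar = {g. fps_nth g 0 = 0 \<and> fps_nth (fps_deriv g) 0 \<noteq> 0}"

definition taylor_at_0 :: "'a::field fps \<Rightarrow> nat \<Rightarrow> 'a" where
  "taylor_at_0 g j = fps_nth ((fps_deriv ^^ j) g) 0"

definition Gamma_poly_gen :: "'a::field_char_0 fps \<Rightarrow> 'a fps \<Rightarrow> nat \<Rightarrow> 'a ratfun" where
  "Gamma_poly_gen a \<phi> n =
     (\<Sum>k\<le>n. rconst (\<Sum>j=k..n. of_nat (n choose j) * taylor_at_0 a (n - j) *
                                reval (bell_B j k) (taylor_at_0 \<phi>)) * rvar k)"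

definition Gamma_poly1 :: "'a::field_char_0 fps \<Rightarrow> 'a fps \<Rightarrow> nat \<Rightarrow> 'a ratfun" where
  "Gamma_poly1 a \<phi> n = Gamma_poly_gen a \<phi> n \<circ>\<^sub>R (\<lambda>j. if j = 0 then 0 else rvar j)"

definition Gamma_bar_poly1 :: "'a::field_char_0 fps \<Rightarrow> 'a fps \<Rightarrow> nat \<Rightarrow> 'a ratfun" where
  "Gamma_bar_poly1 a \<phi> n =
     (\<Sum>k\<le>n. rconst (\<Sum>j=k..n. of_nat (j choose k) *
                        reval (recip_R (j - k)) (taylor_at_0 a) *
                        reval (bell_A n j) (taylor_at_0 \<phi>)) * rvar k)"

definition Gamma_poly2 :: "'a::field_char_0 fps \<Rightarrow> 'a fps \<Rightarrow> nat \<Rightarrow> 'a ratfun" where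
  "Gamma_poly2 a \<phi> n = Gamma_poly_gen a \<phi> n"

definition Gamma_bar_poly2 :: "'a::field_char_0 fps \<Rightarrow> 'a fps \<Rightarrow> nat \<Rightarrow> 'a ratfun" where
  "Gamma_bar_poly2 a \<phi> n =
     (\<Sum>k\<le>n. rconst (1 / of_nat (k + 1) *
                (\<Sum>j=k..n. of_nat (j choose k) *
                   reval (recip_R (j - k)) (\<lambda>i. taylor_at_0 a (i + 1) / of_nat (i + 1)) *
                   reval (bell_A n j) (taylor_at_0 \<phi>))) * rvar (k + 1))"

text \<open>\<open>\<F>\<^sub>1\<close> and \<open>\<F>\<^sup>*\<close> are disjoint; only first arguments from their union are of interest.\<close>

definition Gamma_poly :: "'a::field_char_0 fps \<Rightarrow> 'a fps \<Rightarrow> nat \<Rightarrow> 'a ratfun" where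
  "Gamma_poly a \<phi> n = (if a \<in> fps_F1 then Gamma_poly1 a \<phi> n else Gamma_poly2 a \<phi> n)"

definition Gamma_bar_poly :: "'a::field_char_0 fps \<Rightarrow> 'a fps \<Rightarrow> nat \<Rightarrow> 'a ratfun" where
  "Gamma_bar_poly a \<phi> n = (if a \<in> fps_F1 then Gamma_bar_poly1 a \<phi> n else Gamma_bar_poly2 a \<phi> n)"

definition Lambda_poly ::
  "'a::field_char_0 fps \<Rightarrow> 'a fps \<Rightarrow> 'a fps \<Rightarrow> 'a fps \<Rightarrow> nat \<Rightarrow> 'a ratfun" where
  "Lambda_poly a \<phi> b \<psi> n = Gamma_bar_poly b \<psi> n \<circ>\<^sub>R (\<lambda>j. bell_A j 1 \<circ>\<^sub>R Gamma_poly a \<phi>)"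

lemma poly_mapping_single_induct [case_names single add]:
  fixes p :: "'k \<Rightarrow>\<^sub>0 'v::ab_group_add"
  assumes single: "\<And>k c. P (Poly_Mapping.single k c)"
    and add: "\<And>p q. P p \<Longrightarrow> P q \<Longrightarrow> P (p + q)"
  shows "P p"
proof (induction "card (Poly_Mapping.keys p)" arbitrary: p)
  case 0
  then have "p = Poly_Mapping.single undefined 0" by simp
  with single show ?case by metis
next
  case (Suc n)
  then obtain k where k: "k \<in> Poly_Mapping.keys p"
    by fastforce
  define q where "q = p - Poly_Mapping.single k (Poly_Mapping.lookup p k)"
  have "Poly_Mapping.keys q = Poly_Mapping.keys p - {k}"
    by (auto simp: q_def in_keys_iff lookup_minus lookup_single when_def split: if_splits)
  with Suc k have "P q" by simp
  with single have "P (Poly_Mapping.single k (Poly_Mapping.lookup p k) + q)"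
    by (rule add)
  then show ?case by (simp add: q_def)
qed

lemma mpol_insert_superset:
  assumes "finite S" "Poly_Mapping.keys p \<subseteq> S" "\<iota> 0 = 0"
  shows "mpol_insert \<iota> v p =
     (\<Sum>m\<in>S. \<iota> (Poly_Mapping.lookup p m) *
        (\<Prod>i\<in>Poly_Mapping.keys m. v i ^ Poly_Mapping.lookup m i))"
  unfolding mpol_insert_def
  by (rule sum.mono_neutral_left) (use assms in \<open>auto simp: in_keys_iff\<close>)

locale field_embedding =
  fixes \<iota> :: "'a::field \<Rightarrow> 'b::field"
  assumes emb_0: "\<iota> 0 = 0" and emb_1: "\<iota> 1 = 1"
    and emb_add: "\<iota> (x + y) = \<iota> x + \<iota> y" and emb_mult: "\<iota> (x * y) = \<iota> x * \<iota> y"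
begin

lemma mpol_insert_add: "mpol_insert \<iota> v (p + q) = mpol_insert \<iota> v p + mpol_insert \<iota> v q"
proof -
  let ?S = "Poly_Mapping.keys p \<union> Poly_Mapping.keys q"
  have "Poly_Mapping.keys (p + q) \<subseteq> ?S"
    by (rule Poly_Mapping.keys_add)
  then show ?thesis
    by (subst (1 2 3) mpol_insert_superset[of ?S])
       (auto simp: emb_0 lookup_add emb_add distrib_right sum.distrib)
qed

lemma mpol_insert_single:
  "mpol_insert \<iota> v (Poly_Mapping.single m c) =
     \<iota> c * (\<Prod>i\<in>Poly_Mapping.keys m. v i ^ Poly_Mapping.lookup m i)"
  by (subst mpol_insert_superset[of "{m}"]) (auto simp: emb_0)

lemma mpol_insert_mult: "mpol_insert \<iota> v (p * q) = mpol_insert \<iota> v p * mpol_insert \<iota> v q"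
proof -
  define e where "e m = (\<Prod>i\<in>Poly_Mapping.keys m. v i ^ Poly_Mapping.lookup m i)" for m
  have e_sup: "e m = (\<Prod>i\<in>S. v i ^ Poly_Mapping.lookup m i)"
    if "finite S" "Poly_Mapping.keys m \<subseteq> S" for m S
    unfolding e_def by (rule prod.mono_neutral_left) (use that in \<open>auto simp: in_keys_iff\<close>)
  have e_add: "e (m + n) = e m * e n" for m n
  proof -
    let ?S = "Poly_Mapping.keys m \<union> Poly_Mapping.keys n"
    have "Poly_Mapping.keys (m + n) \<subseteq> ?S"
      by (rule Poly_Mapping.keys_add)
    then show ?thesis
      by (subst (1 2 3) e_sup[of ?S]) (auto simp: lookup_add power_add prod.distrib)
  qed
  have "mpol_insert \<iota> v (Poly_Mapping.single m c * q) =
        mpol_insert \<iota> v (Poly_Mapping.single m c) * mpol_insert \<iota> v q" for m c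
    by (induction q rule: poly_mapping_single_induct)
       (auto simp: mult_single mpol_insert_single emb_mult e_add[unfolded e_def]
          distrib_left mpol_insert_add)
  then show ?thesis
    by (induction p rule: poly_mapping_single_induct) (auto simp: distrib_right mpol_insert_add)
qed

lemma ratfun_insert_Fract:
  assumes "mpol_insert \<iota> v q \<noteq> 0"
  shows "ratfun_insert \<iota> v (Fraction_Field.Fract p q) = mpol_insert \<iota> v p / mpol_insert \<iota> v q"
proof -
  have nz: "q' \<noteq> 0" if "mpol_insert \<iota> v q' \<noteq> 0" for q'
    using that by (auto simp: mpol_insert_def)
  show ?thesis
    unfolding ratfun_insert_def
  proof (rule the_equality)
    fix y
    assume "\<exists>p' q'. Fraction_Field.Fract p q = Fraction_Field.Fract p' q' \<and> mpol_insert \<iota> v q' \<noteq> 0 \<and>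
              y = mpol_insert \<iota> v p' / mpol_insert \<iota> v q'"
    then obtain p' q' where *: "Fraction_Field.Fract p q = Fraction_Field.Fract p' q'" "mpol_insert \<iota> v q' \<noteq> 0"
      "y = mpol_insert \<iota> v p' / mpol_insert \<iota> v q'" by blast
    then have "p * q' = p' * q"
      using nz assms by (simp add: eq_fract)
    then have "mpol_insert \<iota> v p * mpol_insert \<iota> v q' = mpol_insert \<iota> v p' * mpol_insert \<iota> v q"
      by (metis mpol_insert_mult)
    with * assms show "y = mpol_insert \<iota> v p / mpol_insert \<iota> v q"
      by (simp add: frac_eq_eq)
  qed (use assms in blast)
qed

end

interpretation reval: field_embedding "\<lambda>x::'a::field. x"
  by standard auto

interpretation rsubst: field_embedding "rconst :: 'a::field \<Rightarrow> 'a ratfun"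
  by standard (auto simp: rconst_def Zero_fract_def One_fract_def single_add mult_single)

lemma lower_triangular_inverse_ex1:
  fixes B :: "nat \<Rightarrow> nat \<Rightarrow> 'b::field"
  assumes diag: "\<And>k. B k k \<noteq> 0"
  shows "\<exists>!A. (\<forall>n k. k > n \<longrightarrow> A n k = 0) \<and>
     (\<forall>n k. k \<le> n \<longrightarrow> (\<Sum>j=k..n. A n j * B j k) = (if n = k then 1 else 0))"
proof (rule ex_ex1I)
  define step where "step f n k =
     (if k > n then 0
      else ((if n = k then 1 else 0) - (\<Sum>j=Suc k..n. f n j * B j k)) / B k k)"
    for f :: "nat \<Rightarrow> nat \<Rightarrow> 'b" and n k
  define R where "R = measure (\<lambda>(n, k). n - k :: nat)"
  define A where "A n k = wfrec R (\<lambda>f (n, k). step (curry f) n k) (n, k)" for n k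
  have A_rec: "A n k = step A n k" for n k
  proof -
    have wf: "wf R" by (simp add: R_def)
    have "A n k = step (curry (cut (wfrec R (\<lambda>f (n, k). step (curry f) n k)) R (n, k))) n k"
      unfolding A_def by (subst wfrec[OF wf]) simp
    also have "\<dots> = step A n k"
    proof -
      have "curry (cut (wfrec R (\<lambda>f (n, k). step (curry f) n k)) R (n, k)) n j = A n j"
        if "j \<in> {Suc k..n}" for j
        using that by (auto simp: cut_def R_def A_def)
      then have "(\<Sum>j=Suc k..n. curry (cut (wfrec R (\<lambda>f (n, k). step (curry f) n k)) R (n, k)) n j * B j k)
            = (\<Sum>j=Suc k..n. A n j * B j k)"
        by (intro sum.cong) auto
      then show ?thesis
        by (simp only: step_def)
    qed
    finally show ?thesis .
  qed
  have "(\<Sum>j=k..n. A n j * B j k) = (if n = k then 1 else 0)" if "k \<le> n" for n k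
  proof -
    have "(\<Sum>j=k..n. A n j * B j k) = A n k * B k k + (\<Sum>j=Suc k..n. A n j * B j k)"
      using that by (rule sum.atLeast_Suc_atMost)
    also have "A n k * B k k = (if n = k then 1 else 0) - (\<Sum>j=Suc k..n. A n j * B j k)"
      using that diag[of k] by (subst A_rec) (simp add: step_def)
    finally show ?thesis by simp
  qed
  moreover have "A n k = 0" if "k > n" for n k
    using that by (subst A_rec) (simp add: step_def)
  ultimately show "\<exists>A. (\<forall>n k. k > n \<longrightarrow> A n k = 0) \<and>
     (\<forall>n k. k \<le> n \<longrightarrow> (\<Sum>j=k..n. A n j * B j k) = (if n = k then 1 else 0))"
    by blast
next
  fix A A' :: "nat \<Rightarrow> nat \<Rightarrow> 'b"
  assume A: "(\<forall>n k. k > n \<longrightarrow> A n k = 0) \<and>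
     (\<forall>n k. k \<le> n \<longrightarrow> (\<Sum>j=k..n. A n j * B j k) = (if n = k then 1 else 0))"
  assume A': "(\<forall>n k. k > n \<longrightarrow> A' n k = 0) \<and>
     (\<forall>n k. k \<le> n \<longrightarrow> (\<Sum>j=k..n. A' n j * B j k) = (if n = k then 1 else 0))"
  have "A n k = A' n k" for n k
  proof (induction "n - k" arbitrary: k rule: less_induct)
    case less
    show ?case
    proof (cases "k > n")
      case False
      have "(\<Sum>j=k..n. A n j * B j k) = (\<Sum>j=k..n. A' n j * B j k)"
        using A A' False by simp
      moreover have "(\<Sum>j=Suc k..n. A n j * B j k) = (\<Sum>j=Suc k..n. A' n j * B j k)"
        by (rule sum.cong) (use less in auto)
      ultimately have "A n k * B k k = A' n k * B k k"
        using False by (simp add: sum.atLeast_Suc_atMost)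
      then show ?thesis using diag[of k] by simp
    qed (use A A' in simp)
  qed
  then show "A = A'" by blast
qed

lemma bell_types_diag: "n > 0 \<Longrightarrow> bell_types n n = {\<lambda>i. if i = 1 then n else 0}"
proof (intro equalityI subsetI)
  fix r assume n: "n > 0" and "r \<in> bell_types n n"
  then have r: "\<forall>i. i \<notin> {1..n} \<longrightarrow> r i = 0" "(\<Sum>i=1..n. r i) = n" "(\<Sum>i=1..n. i * r i) = n"
    by (auto simp: bell_types_def)
  have "(\<Sum>i=1..n. (i - 1) * r i) + (\<Sum>i=1..n. r i) = (\<Sum>i=1..n. i * r i)"
    unfolding sum.distrib[symmetric] by (rule sum.cong) (auto simp: algebra_simps)
  with r have "(\<Sum>i=1..n. (i - 1) * r i) = 0" by simp
  then have z: "r i = 0" if "i \<noteq> 1" for i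
    using that r(1) by (cases "i \<in> {1..n}") (auto dest!: bspec[of _ _ i])
  have "(\<Sum>i=1..n. r i) = (\<Sum>i\<in>{1}. r i)"
    by (rule sum.mono_neutral_right) (use n z in auto)
  with r(2) z show "r \<in> {\<lambda>i. if i = 1 then n else 0}" by auto
next
  fix r :: "nat \<Rightarrow> nat" assume n: "n > 0" and "r \<in> {\<lambda>i. if i = 1 then n else 0}"
  then have r: "r = (\<lambda>i. if i = 1 then n else 0)" by simp
  have "(\<Sum>i=1..n. r i) = n" "(\<Sum>i=1..n. i * r i) = n"
    using n by (simp_all add: r if_distrib sum.delta cong: if_cong)
  then show "r \<in> bell_types n n" using n by (auto simp: bell_types_def r)
qed

lemma single_eq_0_iff: "Poly_Mapping.single k c = 0 \<longleftrightarrow> c = 0"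
  by (metis lookup_single_eq lookup_zero single_zero)

lemma rvar_nonzero: "rvar j \<noteq> (0 :: 'a::field ratfun)"
  by (simp add: rvar_def Zero_fract_def eq_fract single_eq_0_iff)

lemma bell_B_diag_nonzero: "bell_B n n \<noteq> (0 :: 'a::field_char_0 ratfun)"
proof (cases "n = 0")
  case False
  have "rconst c \<noteq> (0 :: 'a ratfun)" if "c \<noteq> 0" for c
    using that by (auto simp: rconst_def Zero_fract_def eq_fract single_eq_0_iff)
  then show ?thesis
    using False by (auto simp: bell_B_def bell_types_diag rvar_nonzero)
qed (simp add: bell_B_def)

lemma is_bell_inverse_ex1: "\<exists>!A :: nat \<Rightarrow> nat \<Rightarrow> 'a::field_char_0 ratfun. is_bell_inverse A"
proof -
  have *: "is_bell_inverse A \<longleftrightarrow> (\<forall>n k. k > n \<longrightarrow> A n k = 0) \<and>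
     (\<forall>n k. k \<le> n \<longrightarrow> (\<Sum>j=k..n. A n j * bell_B j k) = (if n = k then 1 else 0))"
    for A :: "nat \<Rightarrow> nat \<Rightarrow> 'a ratfun"
  proof -
    have "(\<Sum>j=0..n. A n j * bell_B j 0) = A n 0" for n
    proof -
      have "(\<Sum>j=0..n. A n j * bell_B j 0) = (\<Sum>j\<in>{0}. A n j * bell_B j 0)"
        by (rule sum.mono_neutral_right) (auto simp: bell_B_def)
      then show ?thesis by (simp add: bell_B_def)
    qed
    then have "A n 0 = (if n = 0 then 1 else 0)"
      if "\<forall>n k. k \<le> n \<longrightarrow> (\<Sum>j=k..n. A n j * bell_B j k) = (if n = k then 1 else 0)" for n
      using that[rule_format, of 0 n] by simp
    then show ?thesis
      unfolding is_bell_inverse_def by auto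
  qed
  show ?thesis
    unfolding * by (rule lower_triangular_inverse_ex1[OF bell_B_diag_nonzero])
qed

lemma is_bell_inverse_bell_A: "is_bell_inverse bell_A"
  unfolding bell_A_def by (rule theI'[OF is_bell_inverse_ex1])

end

theory Submission
  imports Defs
begin

text \<open>
  Let \<open>\<iota> : \<bbbK> \<rightarrow> L\<close> be a field embedding. Evaluated at a point of \<open>L\<close>, \<open>\<Gamma>\<^sub>\<bullet>(a, \<phi>)\<close> sends the
  coefficients \<open>c\<close> to the Taylor coefficients of \<open>a \<cdot> (C \<circ> \<phi>)\<close>, where
  \<open>C = \<Sum> c\<^sub>n x\<^sup>n / n!\<close>; \<open>A\<^bsub>\<bullet>,1\<^esub>\<close> sends the Taylor coefficients of a series to those of its
  compositional inverse; and \<open>\<Gamma>\<close>-bar is a linear map with coefficients in \<open>\<bbbK>\<close> inverse to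
  \<open>\<Gamma>\<close>, as it sends \<open>h\<close> to the Taylor coefficients of \<open>(h / a) \<circ> \<phi>\<^sup>-\<^sup>1\<close>. With \<open>L = \<bbbK>\<close> this
  yields the formulas for \<open>c\<^sub>n\<close> and \<open>d\<^sub>n\<close>. With \<open>L = \<bbbK>(X\<^sub>0, X\<^sub>1, \<dots>)\<close> and the generic point
  \<open>(X\<^sub>0, X\<^sub>1, \<dots>)\<close> it yields the identity between rational functions, because inverting a series
  twice returns it.
\<close>

section \<open>Evaluation of rational functions\<close>

text \<open>Taylor coefficients over the field of rational functions require dividing by factorials
  there. Since that field also serves as a target of evaluation, it must have characteristic
  zero.\<close>

instance fract :: ("{idom, ring_char_0}") field_char_0
proof
  have *: "(of_nat n :: 'a fract) = Fraction_Field.Fract (of_nat n) 1" for n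
    by (induction n) (simp_all add: Zero_fract_def One_fract_def)
  show "inj (of_nat :: nat \<Rightarrow> 'a fract)"
    by (rule injI) (simp add: * eq_fract)
qed

context field_embedding
begin

text \<open>The value is specified only where some representing fraction has a nonvanishing
  denominator. Such rational functions form a local ring at \<open>v\<close> on which evaluation is
  a ring homomorphism; the \<open>insert_\<close> lemmas therefore establish definedness together
  with the value.\<close>

definition defined_at :: "(nat \<Rightarrow> 'b) \<Rightarrow> 'a ratfun \<Rightarrow> bool" where
  "defined_at v P \<longleftrightarrow> (\<exists>p q. P = Fraction_Field.Fract p q \<and> mpol_insert \<iota> v q \<noteq> 0)"

lemma defined_atE:
  assumes "defined_at v P"
  obtains p q where "P = Fraction_Field.Fract p q" "mpol_insert \<iota> v q \<noteq> 0" "q \<noteq> 0"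
    "ratfun_insert \<iota> v P = mpol_insert \<iota> v p / mpol_insert \<iota> v q"
proof -
  from assms obtain p q where *: "P = Fraction_Field.Fract p q" "mpol_insert \<iota> v q \<noteq> 0"
    unfolding defined_at_def by blast
  moreover have "q \<noteq> 0" using *(2) by (auto simp: mpol_insert_def)
  ultimately show ?thesis using that ratfun_insert_Fract by blast
qed

lemma defined_at_Fract: "mpol_insert \<iota> v q \<noteq> 0 \<Longrightarrow> defined_at v (Fraction_Field.Fract p q)"
  unfolding defined_at_def by blast

lemma mpol_insert_one: "mpol_insert \<iota> v 1 = 1"
  using mpol_insert_single[of v 0 1] by (simp add: emb_1)

lemma insert_rconst: "defined_at v (rconst c)" "ratfun_insert \<iota> v (rconst c) = \<iota> c"
  unfolding rconst_def
  by (simp_all add: defined_at_Fract ratfun_insert_Fract mpol_insert_one mpol_insert_single)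

lemma insert_rvar: "defined_at v (rvar j)" "ratfun_insert \<iota> v (rvar j) = v j"
  unfolding rvar_def
  by (simp_all add: defined_at_Fract ratfun_insert_Fract mpol_insert_one mpol_insert_single emb_1)

lemma insert_add:
  assumes "defined_at v P" "defined_at v P'"
  shows "defined_at v (P + P')"
    and "ratfun_insert \<iota> v (P + P') = ratfun_insert \<iota> v P + ratfun_insert \<iota> v P'"
proof -
  obtain p q where 1:
    "P = Fraction_Field.Fract p q" "mpol_insert \<iota> v q \<noteq> 0" "q \<noteq> 0"
    "ratfun_insert \<iota> v P = mpol_insert \<iota> v p / mpol_insert \<iota> v q"
    using assms(1) by (rule defined_atE)
  obtain p' q' where 2:
    "P' = Fraction_Field.Fract p' q'" "mpol_insert \<iota> v q' \<noteq> 0" "q' \<noteq> 0"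
    "ratfun_insert \<iota> v P' = mpol_insert \<iota> v p' / mpol_insert \<iota> v q'"
    using assms(2) by (rule defined_atE)
  note * = 1 2
  have eq: "P + P' = Fraction_Field.Fract (p * q' + p' * q) (q * q')"
    using * by simp
  show "defined_at v (P + P')"
    unfolding eq by (rule defined_at_Fract) (use * in \<open>simp add: mpol_insert_mult\<close>)
  show "ratfun_insert \<iota> v (P + P') = ratfun_insert \<iota> v P + ratfun_insert \<iota> v P'"
    unfolding eq by (subst ratfun_insert_Fract)
      (use * in \<open>simp_all add: mpol_insert_mult mpol_insert_add add_frac_eq\<close>)
qed

lemma insert_mult:
  assumes "defined_at v P" "defined_at v P'"
  shows "defined_at v (P * P')"
    and "ratfun_insert \<iota> v (P * P') = ratfun_insert \<iota> v P * ratfun_insert \<iota> v P'"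
proof -
  obtain p q where 1:
    "P = Fraction_Field.Fract p q" "mpol_insert \<iota> v q \<noteq> 0" "q \<noteq> 0"
    "ratfun_insert \<iota> v P = mpol_insert \<iota> v p / mpol_insert \<iota> v q"
    using assms(1) by (rule defined_atE)
  obtain p' q' where 2:
    "P' = Fraction_Field.Fract p' q'" "mpol_insert \<iota> v q' \<noteq> 0" "q' \<noteq> 0"
    "ratfun_insert \<iota> v P' = mpol_insert \<iota> v p' / mpol_insert \<iota> v q'"
    using assms(2) by (rule defined_atE)
  note * = 1 2
  have eq: "P * P' = Fraction_Field.Fract (p * p') (q * q')"
    using * by simp
  show "defined_at v (P * P')"
    unfolding eq by (rule defined_at_Fract) (use * in \<open>simp add: mpol_insert_mult\<close>)
  show "ratfun_insert \<iota> v (P * P') = ratfun_insert \<iota> v P * ratfun_insert \<iota> v P'"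
    unfolding eq by (subst ratfun_insert_Fract) (use * in \<open>simp_all add: mpol_insert_mult\<close>)
qed

lemma insert_inverse:
  assumes "defined_at v P" "ratfun_insert \<iota> v P \<noteq> 0"
  shows "defined_at v (inverse P)"
    and "ratfun_insert \<iota> v (inverse P) = inverse (ratfun_insert \<iota> v P)"
proof -
  obtain p q where *:
    "P = Fraction_Field.Fract p q" "mpol_insert \<iota> v q \<noteq> 0"
    "ratfun_insert \<iota> v P = mpol_insert \<iota> v p / mpol_insert \<iota> v q"
    using assms(1) by (rule defined_atE)
  moreover have "mpol_insert \<iota> v p \<noteq> 0" using * assms(2) by auto
  ultimately show "defined_at v (inverse P)"
    and "ratfun_insert \<iota> v (inverse P) = inverse (ratfun_insert \<iota> v P)"
    by (simp_all add: defined_at_Fract ratfun_insert_Fract)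
qed

lemma insert_0: "defined_at v 0" "ratfun_insert \<iota> v 0 = 0"
  using insert_rconst[of v 0] by (simp_all add: emb_0 rsubst.emb_0)

lemma insert_1: "defined_at v 1" "ratfun_insert \<iota> v 1 = 1"
  using insert_rconst[of v 1] by (simp_all add: emb_1 rsubst.emb_1)

lemma insert_divide:
  assumes "defined_at v P" "defined_at v P'" "ratfun_insert \<iota> v P' \<noteq> 0"
  shows "defined_at v (P / P')"
    and "ratfun_insert \<iota> v (P / P') = ratfun_insert \<iota> v P / ratfun_insert \<iota> v P'"
  using assms by (simp_all add: divide_inverse insert_mult insert_inverse)

lemma insert_uminus:
  assumes "defined_at v P"
  shows "defined_at v (- P)" and "ratfun_insert \<iota> v (- P) = - ratfun_insert \<iota> v P"
proof -
  have "- P = rconst (- 1) * P"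
    using rsubst.emb_add[of 1 "- 1 :: 'a"]
    by (simp add: rsubst.emb_0 rsubst.emb_1 add_eq_0_iff)
  moreover have "\<iota> (- 1) = - 1"
    using emb_add[of 1 "- 1"] by (simp add: emb_0 emb_1 add_eq_0_iff)
  ultimately show "defined_at v (- P)" and "ratfun_insert \<iota> v (- P) = - ratfun_insert \<iota> v P"
    using assms by (simp_all add: insert_mult insert_rconst)
qed

lemma insert_diff:
  assumes "defined_at v P" "defined_at v P'"
  shows "defined_at v (P - P')"
    and "ratfun_insert \<iota> v (P - P') = ratfun_insert \<iota> v P - ratfun_insert \<iota> v P'"
  unfolding diff_conv_add_uminus using assms by (simp_all only: insert_add insert_uminus)

lemma insert_sum:
  assumes "\<And>i. i \<in> I \<Longrightarrow> defined_at v (P i)"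
  shows "defined_at v (\<Sum>i\<in>I. P i)"
    and "ratfun_insert \<iota> v (\<Sum>i\<in>I. P i) = (\<Sum>i\<in>I. ratfun_insert \<iota> v (P i))"
proof -
  have "defined_at v (\<Sum>i\<in>I. P i) \<and>
    ratfun_insert \<iota> v (\<Sum>i\<in>I. P i) = (\<Sum>i\<in>I. ratfun_insert \<iota> v (P i))"
    using assms by (induction I rule: infinite_finite_induct) (auto simp: insert_0 insert_add)
  then show "defined_at v (\<Sum>i\<in>I. P i)"
    and "ratfun_insert \<iota> v (\<Sum>i\<in>I. P i) = (\<Sum>i\<in>I. ratfun_insert \<iota> v (P i))" by auto
qed

lemma insert_prod:
  assumes "\<And>i. i \<in> I \<Longrightarrow> defined_at v (P i)"
  shows "defined_at v (\<Prod>i\<in>I. P i)"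
    and "ratfun_insert \<iota> v (\<Prod>i\<in>I. P i) = (\<Prod>i\<in>I. ratfun_insert \<iota> v (P i))"
proof -
  have "defined_at v (\<Prod>i\<in>I. P i) \<and>
    ratfun_insert \<iota> v (\<Prod>i\<in>I. P i) = (\<Prod>i\<in>I. ratfun_insert \<iota> v (P i))"
    using assms by (induction I rule: infinite_finite_induct) (auto simp: insert_1 insert_mult)
  then show "defined_at v (\<Prod>i\<in>I. P i)"
    and "ratfun_insert \<iota> v (\<Prod>i\<in>I. P i) = (\<Prod>i\<in>I. ratfun_insert \<iota> v (P i))" by auto
qed

lemma insert_power:
  assumes "defined_at v P"
  shows "defined_at v (P ^ n)" and "ratfun_insert \<iota> v (P ^ n) = ratfun_insert \<iota> v P ^ n"
  using insert_prod[of "{..<n}" v "\<lambda>_. P"] assms by simp_all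

lemma insert_mpol_insert:
  assumes "\<And>j. defined_at v (Q j)"
  shows "defined_at v (mpol_insert rconst Q p)"
    and "ratfun_insert \<iota> v (mpol_insert rconst Q p) = mpol_insert \<iota> (\<lambda>j. ratfun_insert \<iota> v (Q j)) p"
  unfolding mpol_insert_def using assms
  by (simp_all add: insert_sum insert_prod insert_mult insert_power insert_rconst)

text \<open>Nested substitutions are thereby evaluated from the inside out, which is how the
  composite \<open>Lambda_poly\<close> is handled later.\<close>

lemma insert_rsubst:
  assumes Q: "\<And>j. defined_at v (Q j)"
    and P: "defined_at (\<lambda>j. ratfun_insert \<iota> v (Q j)) P"
  shows "defined_at v (P \<circ>\<^sub>R Q)"
    and "ratfun_insert \<iota> v (P \<circ>\<^sub>R Q) = ratfun_insert \<iota> (\<lambda>j. ratfun_insert \<iota> v (Q j)) P"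
proof -
  let ?w = "\<lambda>j. ratfun_insert \<iota> v (Q j)"
  obtain p q where pq: "P = Fraction_Field.Fract p q" "mpol_insert \<iota> ?w q \<noteq> 0"
    "ratfun_insert \<iota> ?w P = mpol_insert \<iota> ?w p / mpol_insert \<iota> ?w q"
    using P by (rule defined_atE)
  \<comment> \<open>A rational function whose value at \<open>v\<close> is nonzero is itself
    nonzero. Hence the denominator survives the substitution of \<open>Q\<close>.\<close>
  have "mpol_insert rconst Q q \<noteq> 0"
    using pq(2) insert_mpol_insert(2)[of v Q q, OF Q] insert_0(2)[of v] by auto
  then have eq: "P \<circ>\<^sub>R Q = mpol_insert rconst Q p / mpol_insert rconst Q q"
    by (simp add: rsubst_def pq(1) rsubst.ratfun_insert_Fract)
  show "defined_at v (P \<circ>\<^sub>R Q)" "ratfun_insert \<iota> v (P \<circ>\<^sub>R Q) = ratfun_insert \<iota> ?w P"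
    unfolding eq using pq Q by (simp_all add: insert_divide insert_mpol_insert)
qed

end

section \<open>The generic point\<close>

lemma rvar_power:
  "rvar i ^ k = Fraction_Field.Fract (Poly_Mapping.single (Poly_Mapping.single i k) 1) 1"
  by (induction k)
    (simp_all add: rvar_def One_fract_def mult_single single_add[symmetric])

lemma prod_rvar_power:
  assumes "finite S"
  shows "(\<Prod>i\<in>S. rvar i ^ r i) =
    Fraction_Field.Fract (Poly_Mapping.single (\<Sum>i\<in>S. Poly_Mapping.single i (r i)) 1) 1"
  using assms by (induction S rule: finite_induct)
    (simp_all add: rvar_power One_fract_def mult_single)

lemma mpol_insert_rvar: "mpol_insert rconst rvar p = Fraction_Field.Fract p 1"
proof (induction p rule: poly_mapping_single_induct)
  case (single m c)
  have m: "(\<Sum>i\<in>Poly_Mapping.keys m. Poly_Mapping.single i (Poly_Mapping.lookup m i)) = m"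
    by (rule poly_mapping_eqI) (auto simp: lookup_sum lookup_single when_def in_keys_iff)
  show ?case
    unfolding rsubst.mpol_insert_single prod_rvar_power[OF finite_keys] m
    by (simp add: rconst_def mult_single)
next
  case (add p q)
  then show ?case by (simp add: rsubst.mpol_insert_add)
qed

text \<open>At the generic point every rational function is its own value, so an equation between
  values there is an equation between rational functions.\<close>

lemma rsubst_rvar: "P \<circ>\<^sub>R rvar = P"
proof -
  obtain p q where P: "P = Fraction_Field.Fract p q" "q \<noteq> 0" by (cases P)
  then have "mpol_insert rconst rvar q \<noteq> 0"
    by (simp add: mpol_insert_rvar Zero_fract_def eq_fract)
  then show ?thesis
    unfolding P rsubst_def by (simp add: rsubst.ratfun_insert_Fract mpol_insert_rvar)
qed

section \<open>Bell polynomials and powers of series\<close>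

definition compositions_on :: "'i set \<Rightarrow> nat \<Rightarrow> ('i \<Rightarrow> nat) set" where
  "compositions_on S k = {r. (\<forall>i. i \<notin> S \<longrightarrow> r i = 0) \<and> (\<Sum>i\<in>S. r i) = k}"

lemma finite_compositions_on:
  assumes "finite S"
  shows "finite (compositions_on S k)"
proof (rule finite_subset)
  show "compositions_on S k \<subseteq> {r. \<forall>i. (i \<in> S \<longrightarrow> r i \<in> {..k}) \<and> (i \<notin> S \<longrightarrow> r i = 0)}"
    using assms by (auto simp: compositions_on_def intro: member_le_sum)
  show "finite {r. \<forall>i. (i \<in> S \<longrightarrow> r i \<in> {..k}) \<and> (i \<notin> S \<longrightarrow> r i = (0::nat))}"
    using assms by (rule finite_set_of_finite_funs) simp
qed

text \<open>The multinomial theorem in terms of divided powers \<open>p k x = x\<^sup>k / k!\<close>, of which only the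
  binomial theorem is used.\<close>

lemma divided_power_sum:
  fixes p :: "nat \<Rightarrow> 'r::comm_ring_1 \<Rightarrow> 'r" and S :: "'i set"
  assumes p_0: "\<And>k. p k 0 = (if k = 0 then 1 else 0)"
    and p_add: "\<And>k x y. p k (x + y) = (\<Sum>j\<le>k. p j x * p (k - j) y)"
    and "finite S"
  shows "p k (\<Sum>i\<in>S. y i) = (\<Sum>r\<in>compositions_on S k. \<Prod>i\<in>S. p (r i) (y i))"
  using \<open>finite S\<close>
proof (induction S arbitrary: k rule: finite_induct)
  case empty
  have "compositions_on ({} :: 'i set) k = (if k = 0 then {\<lambda>_. 0} else {})" for k
    by (auto simp: compositions_on_def)
  then show ?case by (simp add: p_0)
next
  case (insert a S)
  let ?C = "compositions_on S"
  have "p k (\<Sum>i\<in>insert a S. y i) =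
      (\<Sum>j\<le>k. \<Sum>r\<in>?C (k - j). p j (y a) * (\<Prod>i\<in>S. p (r i) (y i)))"
    using insert by (simp add: p_add sum_distrib_left)
  also have "\<dots> = (\<Sum>(j, r)\<in>Sigma {..k} (\<lambda>j. ?C (k - j)). p j (y a) * (\<Prod>i\<in>S. p (r i) (y i)))"
    using insert(1) by (intro sum.Sigma) (auto simp: finite_compositions_on)
  also have "\<dots> = (\<Sum>r\<in>compositions_on (insert a S) k. \<Prod>i\<in>insert a S. p (r i) (y i))"
  \<comment> \<open>A composition indexed by \<open>insert a S\<close> corresponds to its entry
    \<open>j\<close> at \<open>a\<close> together with the remaining entries, with \<open>a\<close>
    reset to zero.\<close>
  proof (rule sum.reindex_bij_witness[where i = "\<lambda>r. (r a, r(a := 0))" and j = "\<lambda>(j, r). r(a := j)"])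
    fix jr assume "jr \<in> Sigma {..k} (\<lambda>j. ?C (k - j))"
    then obtain j r where jr: "jr = (j, r)" "j \<le> k" "\<forall>i. i \<notin> S \<longrightarrow> r i = 0" "sum r S = k - j"
      by (auto simp: compositions_on_def)
    then have "r a = 0" using insert(2) by blast
    then show "(\<lambda>r. (r a, r(a := 0))) ((\<lambda>(j, r). r(a := j)) jr) = jr"
      by (auto simp: jr(1))
    have eq: "sum (r(a := j)) S = sum r S"
      "(\<Prod>i\<in>S. p ((r(a := j)) i) (y i)) = (\<Prod>i\<in>S. p (r i) (y i))"
      using insert(2) by (auto intro!: sum.cong prod.cong)
    show "(\<lambda>(j, r). r(a := j)) jr \<in> compositions_on (insert a S) k"
      using jr insert(1,2) eq(1) by (auto simp: compositions_on_def)
    show "(\<Prod>i\<in>insert a S. p (((\<lambda>(j, r). r(a := j)) jr) i) (y i)) =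
        (case jr of (j, r) \<Rightarrow> p j (y a) * (\<Prod>i\<in>S. p (r i) (y i)))"
      using insert(1,2) eq(2) by (simp add: jr(1))
  next
    fix r assume "r \<in> compositions_on (insert a S) k"
    then have r: "\<forall>i. i \<notin> insert a S \<longrightarrow> r i = 0" "r a + sum r S = k"
      using insert(1,2) by (auto simp: compositions_on_def)
    have "sum (r(a := 0)) S = sum r S"
      using insert(2) by (auto intro!: sum.cong)
    with r show "(r a, r(a := 0)) \<in> Sigma {..k} (\<lambda>j. ?C (k - j))"
      by (auto simp: compositions_on_def)
    show "(\<lambda>(j, r). r(a := j)) (r a, r(a := 0)) = r" by simp
  qed
  finally show ?case .
qed

lemma fps_power_nth_cong:
  fixes f g :: "'a::comm_ring_1 fps"
  assumes "\<And>i. i \<le> n \<Longrightarrow> fps_nth f i = fps_nth g i"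
  shows "fps_nth (f ^ k) n = fps_nth (g ^ k) n"
  using assms
proof (induction k arbitrary: n)
  case (Suc k)
  then show ?case by (auto simp: fps_mult_nth intro!: sum.cong)
qed simp

text \<open>In the multinomial expansion of the divided power of \<open>g\<close>, the term indexed
  by \<open>r\<close> is a monomial of degree \<open>\<Sum>i=1..n. i * r i\<close>. Taking
  coefficient \<open>n\<close> keeps exactly the compositions in
  \<open>bell_types n k\<close>.\<close>

lemma fps_power_nth_bell_types:
  fixes g :: "'a::field_char_0 fps"
  assumes "fps_nth g 0 = 0"
  shows "fps_nth (g ^ k) n / fact k = (\<Sum>r\<in>bell_types n k. \<Prod>i=1..n. fps_nth g i ^ r i / fact (r i))"
proof -
  define p where "p k x = fps_const (1 / fact k) * x ^ k" for k and x :: "'a fps"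
  have p_0: "p k 0 = (if k = 0 then 1 else 0)" for k
    by (simp add: p_def power_0_left)
  have p_add: "p k (x + y) = (\<Sum>j\<le>k. p j x * p (k - j) y)" for k x y
  proof -
    have "p k (x + y) = (\<Sum>j\<le>k. fps_const (1 / fact k) * (of_nat (k choose j) * x ^ j * y ^ (k - j)))"
      unfolding p_def binomial_ring by (rule sum_distrib_left)
    also have "\<dots> = (\<Sum>j\<le>k. p j x * p (k - j) y)"
    proof (rule sum.cong[OF refl])
      fix j assume "j \<in> {..k}"
      then have "1 / fact k * of_nat (k choose j) = (1 / fact j * (1 / fact (k - j)) :: 'a)"
        by (simp add: binomial_fact field_simps)
      then have "fps_const (1 / fact k) * of_nat (k choose j) =
          (fps_const (1 / fact j) * fps_const (1 / fact (k - j)) :: 'a fps)"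
        by (simp flip: fps_of_nat)
      then show "fps_const (1 / fact k) * (of_nat (k choose j) * x ^ j * y ^ (k - j)) =
          p j x * p (k - j) y"
        by (simp add: p_def mult_ac)
    qed
    finally show ?thesis .
  qed
  \<comment> \<open>Truncating \<open>g\<close> at degree \<open>n\<close> leaves coefficient
    \<open>n\<close> of its powers unchanged and gives a finite sum, to which
    \<open>divided_power_sum\<close> applies.\<close>
  define h where "h = (\<Sum>i=1..n. fps_const (fps_nth g i) * fps_X ^ i)"
  have h_nth: "fps_nth h i = fps_nth g i" if "i \<le> n" for i
  proof -
    have "fps_nth h i = (\<Sum>j=1..n. if j = i then fps_nth g j else 0)"
      unfolding h_def fps_sum_nth by (rule sum.cong) auto
    also have "\<dots> = fps_nth g i"
      using that assms by (cases "i = 0") (simp_all add: sum.delta)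
    finally show ?thesis .
  qed
  have p_mono: "(\<Prod>i=1..n. p (r i) (fps_const (fps_nth g i) * fps_X ^ i)) =
      fps_const (\<Prod>i=1..n. fps_nth g i ^ r i / fact (r i)) * fps_X ^ (\<Sum>i=1..n. i * r i)" for r
  proof -
    have "p (r i) (fps_const (fps_nth g i) * fps_X ^ i) =
        fps_const (fps_nth g i ^ r i / fact (r i)) * fps_X ^ (i * r i)" for i
      by (simp add: p_def power_mult_distrib power_mult[symmetric] fps_const_power mult.assoc[symmetric])
    then have "(\<Prod>i=1..n. p (r i) (fps_const (fps_nth g i) * fps_X ^ i)) =
      (\<Prod>i=1..n. fps_const (fps_nth g i ^ r i / fact (r i))) * fps_X ^ (\<Sum>i=1..n. i * r i)"
      by (simp add: prod.distrib power_sum)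
    moreover have "(\<Prod>i=1..n. fps_const (c i)) = fps_const (\<Prod>i=1..n. c i)" for c :: "nat \<Rightarrow> 'a"
      by (induction n) simp_all
    ultimately show ?thesis by simp
  qed
  have "fps_nth (g ^ k) n / fact k = fps_nth (p k h) n"
    using fps_power_nth_cong[of n g h k] h_nth by (simp add: p_def)
  also have "\<dots> = (\<Sum>r\<in>compositions_on {1..n} k.
      if (\<Sum>i=1..n. i * r i) = n then \<Prod>i=1..n. fps_nth g i ^ r i / fact (r i) else 0)"
    unfolding h_def divided_power_sum[of p, OF p_0 p_add finite_atLeastAtMost] p_mono fps_sum_nth
    by (rule sum.cong) auto
  also have "\<dots> = (\<Sum>r\<in>bell_types n k. \<Prod>i=1..n. fps_nth g i ^ r i / fact (r i))"
    using finite_compositions_on[of "{1..n}" k]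
    by (intro sum.mono_neutral_cong_right) (auto simp: bell_types_def compositions_on_def)
  finally show ?thesis .
qed

section \<open>Values of Bell and reciprocal polynomials as Taylor coefficients\<close>

definition egf :: "(nat \<Rightarrow> 'a::field_char_0) \<Rightarrow> 'a fps" where
  "egf v = Abs_fps (\<lambda>n. v n / fact n)"

lemma egf_nth [simp]: "fps_nth (egf v) n = v n / fact n"
  by (simp add: egf_def)

lemma taylor_at_0_eq: "taylor_at_0 (g :: 'a::field_char_0 fps) n = fact n * fps_nth g n"
  by (simp add: taylor_at_0_def fps_0th_higher_deriv)

lemma egf_taylor_at_0 [simp]: "egf (taylor_at_0 g) = (g :: 'a::field_char_0 fps)"
  by (simp add: fps_eq_iff taylor_at_0_eq)

lemma taylor_at_0_egf [simp]: "taylor_at_0 (egf v) = v"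
  by (simp add: fun_eq_iff taylor_at_0_eq)

text \<open>This is coefficient \<open>n\<close> of \<open>(g ^ k) oo fps_inv g = fps_X ^ k\<close>.
  Up to factorials it is the relation that defines \<open>bell_A\<close> from
  \<open>bell_B\<close>.\<close>

lemma fps_compose_fps_inv_power_nth:
  fixes g :: "'a::field fps"
  assumes "fps_nth g 0 = 0" "fps_nth g 1 \<noteq> 0"
  shows "(\<Sum>j=k..n. fps_nth (fps_inv g ^ j) n * fps_nth (g ^ k) j) = (if n = k then 1 else 0)"
proof -
  have "(g ^ k) oo fps_inv g = fps_X ^ k"
    using fps_compose_power[of "fps_inv g" g k] fps_inv_right[OF assms] by (simp add: fps_inv_def)
  then have "(\<Sum>j=0..n. fps_nth (g ^ k) j * fps_nth (fps_inv g ^ j) n) = (if n = k then 1 else 0)"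
    by (metis fps_X_power_nth fps_compose_nth)
  moreover have "(\<Sum>j=k..n. fps_nth (fps_inv g ^ j) n * fps_nth (g ^ k) j) =
      (\<Sum>j=0..n. fps_nth (g ^ k) j * fps_nth (fps_inv g ^ j) n)"
    using startsby_zero_power_prefix[OF assms(1)]
    by (intro sum.mono_neutral_cong_left) auto
  ultimately show ?thesis by simp
qed

locale char_0_embedding = field_embedding \<iota> for \<iota> :: "'a::field_char_0 \<Rightarrow> 'b::field_char_0"
begin

lemma emb_sum: "\<iota> (\<Sum>i\<in>I. h i) = (\<Sum>i\<in>I. \<iota> (h i))"
  by (induction I rule: infinite_finite_induct) (simp_all add: emb_0 emb_add)

lemma emb_prod: "\<iota> (\<Prod>i\<in>I. h i) = (\<Prod>i\<in>I. \<iota> (h i))"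
  by (induction I rule: infinite_finite_induct) (simp_all add: emb_1 emb_mult)

lemma emb_power: "\<iota> (x ^ n) = \<iota> x ^ n"
  by (induction n) (simp_all add: emb_1 emb_mult)

lemma emb_of_nat: "\<iota> (of_nat n) = of_nat n"
  by (induction n) (simp_all add: emb_0 emb_1 emb_add)

lemma emb_fact: "\<iota> (fact n) = fact n"
  by (metis emb_of_nat of_nat_fact)

lemma emb_uminus: "\<iota> (- x) = - \<iota> x"
  using emb_add[of x "- x"] by (simp add: emb_0 eq_neg_iff_add_eq_0 add.commute)

lemma emb_divide: "\<iota> (x / y) = \<iota> x / \<iota> y"
proof (cases "y = 0")
  case False
  have "\<iota> (x / y) * \<iota> y = \<iota> x" "\<iota> y * \<iota> (1 / y) = 1"
    using False by (simp_all add: emb_1 flip: emb_mult)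
  then show ?thesis by (metis mult_zero_left nonzero_eq_divide_eq zero_neq_one)
qed (simp add: emb_0)

text \<open>Bell polynomials do not involve \<open>X\<^sub>0\<close>; resetting \<open>v\<close> at
  index 0 turns it into a series without constant term, whose powers they describe.\<close>

lemma insert_bell_B:
  "defined_at v (bell_B n k)"
  "ratfun_insert \<iota> v (bell_B n k) = fact n / fact k * fps_nth (egf (v(0 := 0)) ^ k) n"
proof -
  \<comment> \<open>The case distinctions in \<open>bell_B\<close> are absorbed by the general sum:
    for \<open>k = 0\<close> only the zero vector can occur, and for \<open>k > n\<close> there is
    no index vector.\<close>
  have "bell_types n 0 = (if n = 0 then {\<lambda>_. 0} else {})"
    by (auto simp: bell_types_def)
  moreover have "bell_types n k = {}" if "k > n"
  proof -
    have "(\<Sum>i=1..n. r i) \<le> (\<Sum>i=1..n. i * r i)" for r :: "nat \<Rightarrow> nat"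
      by (rule sum_mono) auto
    with that show ?thesis unfolding bell_types_def by (metis (mono_tags, lifting) Collect_empty_eq leD)
  qed
  ultimately have eq: "bell_B n k = (\<Sum>r\<in>bell_types n k.
      rconst (fact n / (\<Prod>i=1..n. fact (r i) * fact i ^ r i)) * (\<Prod>i=1..n. rvar i ^ r i) :: 'a ratfun)"
    unfolding bell_B_def by (auto simp: rsubst.emb_1)
  show "defined_at v (bell_B n k)"
    unfolding eq
    by (intro insert_sum insert_mult insert_prod insert_power insert_rconst insert_rvar)
  have "fact n / fact k * fps_nth (egf (v(0 := 0)) ^ k) n =
      fact n * (\<Sum>r\<in>bell_types n k. \<Prod>i=1..n. (v i / fact i) ^ r i / fact (r i))"
  proof -
    have "fact n / fact k * fps_nth (egf (v(0 := 0)) ^ k) n =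
        fact n * (fps_nth (egf (v(0 := 0)) ^ k) n / fact k)"
      by simp
    also have "\<dots> = fact n *
        (\<Sum>r\<in>bell_types n k. \<Prod>i=1..n. fps_nth (egf (v(0 := 0))) i ^ r i / fact (r i))"
      by (subst fps_power_nth_bell_types) simp_all
    finally show ?thesis by simp
  qed
  also have "\<dots> = (\<Sum>r\<in>bell_types n k.
      fact n / (\<Prod>i=1..n. fact (r i) * fact i ^ r i) * (\<Prod>i=1..n. v i ^ r i))"
    unfolding sum_distrib_left
    by (intro sum.cong) (simp_all add: prod_dividef power_divide prod.distrib mult_ac)
  finally show "ratfun_insert \<iota> v (bell_B n k) = fact n / fact k * fps_nth (egf (v(0 := 0)) ^ k) n"
    unfolding eq
    by (simp add: insert_sum insert_mult insert_prod insert_power insert_rconst insert_rvar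
        emb_divide emb_prod emb_mult emb_power emb_fact)
qed

text \<open>The coefficients of the powers of the inverse series solve the same triangular system as
  \<open>bell_A\<close>, by \<open>fps_compose_fps_inv_power_nth\<close>. The assumption makes the
  diagonal values, the powers of \<open>v 1\<close>, nonzero, so the system can be solved after
  evaluation.\<close>

lemma insert_bell_A:
  assumes "v 1 \<noteq> 0"
  shows "defined_at v (bell_A n k)"
    and "ratfun_insert \<iota> v (bell_A n k) = fact n / fact k * fps_nth (fps_inv (egf (v(0 := 0))) ^ k) n"
proof -
  let ?G = "egf (v(0 := 0))"
  let ?b = "\<lambda>j k. fact j / fact k * fps_nth (?G ^ k) j"
  let ?a = "\<lambda>n k. fact n / fact k * fps_nth (fps_inv ?G ^ k) n"
  have G: "fps_nth ?G 0 = 0" "fps_nth ?G 1 \<noteq> 0" using assms by simp_all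
  have ab: "(\<Sum>j=k..n. ?a n j * ?b j k) = (if n = k then 1 else 0)" for k
  proof -
    have "(\<Sum>j=k..n. ?a n j * ?b j k) =
        fact n / fact k * (\<Sum>j=k..n. fps_nth (fps_inv ?G ^ j) n * fps_nth (?G ^ k) j)"
      by (simp add: sum_distrib_left mult_ac)
    then show ?thesis
      unfolding fps_compose_fps_inv_power_nth[OF G] by simp
  qed
  have diag: "?b k k \<noteq> 0" for k
    using assms by (simp add: startsby_zero_power_nth_same)
  have A: "bell_A n k = 0" if "n < k" for n k
    using is_bell_inverse_bell_A that unfolding is_bell_inverse_def by blast
  have AB: "(\<Sum>j=k..n. bell_A n j * bell_B j k) = (if n = k then 1 else 0 :: 'a ratfun)" if "k \<le> n" for k
    using is_bell_inverse_bell_A that unfolding is_bell_inverse_def by blast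
  have "defined_at v (bell_A n k) \<and> ratfun_insert \<iota> v (bell_A n k) = ?a n k"
  \<comment> \<open>Row \<open>n\<close> is solved from the right: the relation in column
    \<open>k\<close> expresses \<open>bell_A n k\<close> by the entries \<open>bell_A n j\<close>
    with \<open>j > k\<close>, divided by \<open>bell_B k k\<close>.\<close>
  proof (induction "n - k" arbitrary: k rule: less_induct)
    case less
    show ?case
    proof (cases "n < k")
      case True
      have "fps_nth (fps_inv ?G) 0 = 0" by (simp add: fps_inv_def)
      with True show ?thesis
        using startsby_zero_power_prefix[of "fps_inv ?G" k] by (simp add: A insert_0)
    next
      case False
      let ?S = "{Suc k..n}"
      have IH: "defined_at v (bell_A n j)" "ratfun_insert \<iota> v (bell_A n j) = ?a n j"
        if "j \<in> ?S" for j
        using less[of j] that by auto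
      let ?N = "(if n = k then 1 else 0) - (\<Sum>j\<in>?S. bell_A n j * bell_B j k) :: 'a ratfun"
      have N: "defined_at v ?N"
        "ratfun_insert \<iota> v ?N = (if n = k then 1 else 0) - (\<Sum>j\<in>?S. ?a n j * ?b j k)"
      proof -
        have AB: "defined_at v (bell_A n j * bell_B j k)"
          "ratfun_insert \<iota> v (bell_A n j * bell_B j k) = ?a n j * ?b j k" if "j \<in> ?S" for j
          using IH[OF that] by (simp_all only: insert_mult insert_bell_B)
        have "defined_at v (\<Sum>j\<in>?S. bell_A n j * bell_B j k)"
          by (rule insert_sum(1)[OF AB(1)])
        moreover have "ratfun_insert \<iota> v (\<Sum>j\<in>?S. bell_A n j * bell_B j k) =
            (\<Sum>j\<in>?S. ?a n j * ?b j k)"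
          using insert_sum(2)[OF AB(1)] sum.cong[OF refl AB(2)] by (rule trans)
        moreover have "defined_at v (if n = k then 1 else 0)"
          "ratfun_insert \<iota> v (if n = k then 1 else 0) = (if n = k then 1 else 0)"
          by (simp_all add: insert_0 insert_1)
        ultimately show "defined_at v ?N"
          "ratfun_insert \<iota> v ?N = (if n = k then 1 else 0) - (\<Sum>j\<in>?S. ?a n j * ?b j k)"
          by (simp_all only: insert_diff)
      qed
      have B: "ratfun_insert \<iota> v (bell_B k k) = ?b k k" by (rule insert_bell_B)
      have "bell_A n k * bell_B k k = ?N"
        using AB[of k] False by (simp add: sum.atLeast_Suc_atMost algebra_simps)
      then have eq: "bell_A n k = ?N / bell_B k k"
        by (metis bell_B_diag_nonzero nonzero_mult_div_cancel_right)
      have "defined_at v (bell_A n k)"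
        unfolding eq by (rule insert_divide(1)[OF N(1) insert_bell_B(1)]) (use B diag in metis)
      moreover have "ratfun_insert \<iota> v (bell_A n k) = ?a n k"
      proof -
        have "ratfun_insert \<iota> v (bell_A n k) =
            ((if n = k then 1 else 0) - (\<Sum>j\<in>?S. ?a n j * ?b j k)) / ?b k k"
          unfolding eq N(2)[symmetric] B[symmetric]
          by (rule insert_divide(2)[OF N(1) insert_bell_B(1)]) (use B diag in metis)
        also have "(if n = k then 1 else 0) - (\<Sum>j\<in>?S. ?a n j * ?b j k) = ?a n k * ?b k k"
          using ab[of k] False by (simp add: sum.atLeast_Suc_atMost algebra_simps)
        also have "?a n k * ?b k k / ?b k k = ?a n k"
          by (rule nonzero_mult_div_cancel_right[OF diag])
        finally show ?thesis .
      qed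
      ultimately show ?thesis ..
    qed
  qed
  then show "defined_at v (bell_A n k)" "ratfun_insert \<iota> v (bell_A n k) = ?a n k" by auto
qed

text \<open>The reciprocal of \<open>egf v\<close> is \<open>1 / (v 0 + x)\<close> composed with
  \<open>egf v - v 0\<close>. Expanding the former as a geometric series gives the sum defining
  \<open>recip_R\<close>.\<close>

lemma insert_recip_R:
  assumes "v 0 \<noteq> 0"
  shows "ratfun_insert \<iota> v (recip_R n) = fact n * fps_nth (inverse (egf v)) n"
proof -
  let ?G = "egf (v(0 := 0))"
  let ?L = "fps_const (v 0) + fps_X"
  have "?L * Abs_fps (\<lambda>k. (- 1) ^ k / v 0 ^ (k + 1)) = 1"
  proof (rule fps_ext)
    fix n
    show "fps_nth (?L * Abs_fps (\<lambda>k. (- 1) ^ k / v 0 ^ (k + 1))) n = fps_nth 1 n"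
      using assms by (cases n) (simp_all add: distrib_right)
  qed
  then have L: "inverse ?L = Abs_fps (\<lambda>k. (- 1) ^ k / v 0 ^ (k + 1))"
    using fps_inverse_unique by metis
  have "?L oo ?G = egf v"
    by (simp add: fps_compose_add_distrib fps_eq_iff)
  moreover have "inverse ?L oo ?G = inverse (?L oo ?G)"
    by (rule fps_inverse_compose) (simp_all add: assms)
  ultimately have "fps_nth (inverse (egf v)) n = fps_nth (inverse ?L oo ?G) n" by simp
  also have "\<dots> = (\<Sum>k\<le>n. (- 1) ^ k / v 0 ^ (k + 1) * fps_nth (?G ^ k) n)"
    unfolding fps_compose_nth L by (simp add: atMost_atLeast0)
  finally have "fact n * fps_nth (inverse (egf v)) n =
      (\<Sum>k\<le>n. (- 1) ^ k * fact k * inverse (v 0 ^ (k + 1)) * (fact n / fact k * fps_nth (?G ^ k) n))"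
    by (simp add: sum_distrib_left field_simps)
  moreover have "ratfun_insert \<iota> v (recip_R n) =
      (\<Sum>k\<le>n. (- 1) ^ k * fact k * inverse (v 0 ^ (k + 1)) * (fact n / fact k * fps_nth (?G ^ k) n))"
    unfolding recip_R_def
    using assms by (simp add: insert_sum insert_mult insert_inverse insert_power insert_rconst
        insert_rvar insert_bell_B emb_mult emb_power emb_fact emb_uminus emb_1 del: power_Suc)
  ultimately show ?thesis by simp
qed

end

section \<open>The linear maps \<open>\<Gamma>\<close> and their inverses\<close>

interpretation reval_0: char_0_embedding "\<lambda>x::'a::field_char_0. x" ..

interpretation rsubst_0: char_0_embedding "rconst :: 'a::field_char_0 \<Rightarrow> 'a ratfun" ..

lemma fps_Fstar_iff: "g \<in> fps_Fstar \<longleftrightarrow> fps_nth g 0 = 0 \<and> fps_nth g 1 \<noteq> (0 :: 'a::field)"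
  by (simp add: fps_Fstar_def)

lemma egf_taylor_at_0_upd:
  "fps_nth g 0 = 0 \<Longrightarrow> egf ((taylor_at_0 g)(0 := 0)) = (g :: 'a::field_char_0 fps)"
  by (simp add: fps_eq_iff taylor_at_0_eq)

lemma reval_bell_B:
  assumes "\<phi> \<in> fps_Fstar"
  shows "reval (bell_B n k) (taylor_at_0 \<phi>) = fact n / fact k * fps_nth (\<phi> ^ k) n"
  using assms by (simp add: reval_def reval_0.insert_bell_B egf_taylor_at_0_upd fps_Fstar_iff)

lemma reval_bell_A:
  assumes "\<phi> \<in> fps_Fstar"
  shows "reval (bell_A n k) (taylor_at_0 \<phi>) = fact n / fact k * fps_nth (fps_inv \<phi> ^ k) n"
proof -
  have "taylor_at_0 \<phi> 1 \<noteq> 0" using assms by (simp add: taylor_at_0_eq fps_Fstar_iff)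
  with assms show ?thesis
    by (simp add: reval_def reval_0.insert_bell_A egf_taylor_at_0_upd fps_Fstar_iff)
qed

lemma reval_recip_R:
  assumes "a \<in> fps_F1"
  shows "reval (recip_R n) (taylor_at_0 a) = fact n * fps_nth (inverse a) n"
proof -
  have "taylor_at_0 a 0 \<noteq> 0" using assms by (simp add: taylor_at_0_eq fps_F1_def)
  then show ?thesis
    by (simp add: reval_def reval_0.insert_recip_R)
qed

text \<open>The exponential Riordan array of \<open>a\<close> and \<open>\<phi>\<close>: the matrix
  of \<open>C \<mapsto> a * (C oo \<phi>)\<close> in the basis \<open>x^k / k!\<close>.\<close>

definition Gamma_coeff :: "'a::field_char_0 fps \<Rightarrow> 'a fps \<Rightarrow> nat \<Rightarrow> nat \<Rightarrow> 'a" where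
  "Gamma_coeff a \<phi> n k = fact n / fact k * fps_nth (a * \<phi> ^ k) n"

lemma Gamma_coeff_eq_0:
  assumes "\<phi> \<in> fps_Fstar" "n < k"
  shows "Gamma_coeff a \<phi> n k = 0"
proof -
  have "fps_nth (a * \<phi> ^ k) n = 0"
    using assms startsby_zero_power_prefix[of \<phi> k] by (auto simp: fps_mult_nth fps_Fstar_iff)
  then show ?thesis by (simp add: Gamma_coeff_def)
qed

text \<open>The inner sum is the binomial convolution of the Taylor coefficients of \<open>a\<close>
  with those of \<open>\<phi> ^ k / k!\<close>. Its missing terms \<open>j < k\<close> vanish
  because \<open>\<phi> ^ k\<close> starts in degree at least \<open>k\<close>.\<close>

lemma Gamma_poly_gen_eq:
  assumes "\<phi> \<in> fps_Fstar"
  shows "Gamma_poly_gen a \<phi> n = (\<Sum>k\<le>n. rconst (Gamma_coeff a \<phi> n k) * rvar k)"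
proof -
  have "(\<Sum>j=k..n. of_nat (n choose j) * taylor_at_0 a (n - j) *
      reval (bell_B j k) (taylor_at_0 \<phi>)) = Gamma_coeff a \<phi> n k" for k
  proof -
    have "(\<Sum>j=k..n. of_nat (n choose j) * taylor_at_0 a (n - j) *
        reval (bell_B j k) (taylor_at_0 \<phi>)) =
        (\<Sum>j=k..n. fact n / fact k * (fps_nth (\<phi> ^ k) j * fps_nth a (n - j)))"
      unfolding reval_bell_B[OF assms]
      by (intro sum.cong) (simp_all add: taylor_at_0_eq binomial_fact)
    also have "\<dots> = (\<Sum>j=0..n. fact n / fact k * (fps_nth (\<phi> ^ k) j * fps_nth a (n - j)))"
      using startsby_zero_power_prefix[of \<phi> k] assms
      by (intro sum.mono_neutral_left) (auto simp: fps_Fstar_iff)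
    also have "\<dots> = Gamma_coeff a \<phi> n k"
      unfolding Gamma_coeff_def mult.commute[of a] fps_mult_nth by (simp add: sum_distrib_left)
    finally show ?thesis .
  qed
  then show ?thesis by (simp add: Gamma_poly_gen_def)
qed

lemma sum_Gamma_coeff:
  assumes "\<phi> \<in> fps_Fstar"
  shows "(\<Sum>k\<le>n. Gamma_coeff a \<phi> n k * c k) = taylor_at_0 (a * (egf c oo \<phi>)) n"
proof -
  have z: "fps_nth (\<phi> ^ k) i = 0" if "i < k" for i k
    using startsby_zero_power_prefix[of \<phi> k] assms that by (auto simp: fps_Fstar_iff)
  have "fps_nth (a * (egf c oo \<phi>)) n =
      (\<Sum>i=0..n. \<Sum>k=0..n - i. fps_nth a i * (c k / fact k * fps_nth (\<phi> ^ k) (n - i)))"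
    by (simp add: fps_mult_nth fps_compose_nth sum_distrib_left)
  \<comment> \<open>The range is made rectangular so that the sums can be exchanged; the added
    coefficients of \<open>\<phi> ^ k\<close> lie below degree \<open>k\<close> and vanish.\<close>
  also have "\<dots> = (\<Sum>i=0..n. \<Sum>k=0..n. fps_nth a i * (c k / fact k * fps_nth (\<phi> ^ k) (n - i)))"
    by (intro sum.cong refl sum.mono_neutral_left) (auto simp: z)
  also have "\<dots> = (\<Sum>k=0..n. \<Sum>i=0..n. fps_nth a i * (c k / fact k * fps_nth (\<phi> ^ k) (n - i)))"
    by (rule sum.swap)
  also have "\<dots> = (\<Sum>k\<le>n. c k / fact k * fps_nth (a * \<phi> ^ k) n)"
    by (simp add: fps_mult_nth sum_distrib_left mult_ac atMost_atLeast0)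
  finally show ?thesis
    by (simp add: taylor_at_0_eq Gamma_coeff_def sum_distrib_left mult_ac)
qed

section \<open>Division by \<open>a\<close> followed by composition with the inverse of
  \<open>\<phi>\<close>\<close>

definition recip_coeff :: "'a::field_char_0 fps \<Rightarrow> 'a fps \<Rightarrow> nat \<Rightarrow> nat \<Rightarrow> 'a" where
  "recip_coeff a \<phi> n k = (\<Sum>j=k..n. of_nat (j choose k) *
     reval (recip_R (j - k)) (taylor_at_0 a) * reval (bell_A n j) (taylor_at_0 \<phi>))"

text \<open>For fixed \<open>j\<close>, summing over \<open>k\<close> is the binomial convolution
  giving the Taylor coefficients of \<open>h / a\<close>; the factors \<open>bell_A n j\<close> then
  carry out the composition with \<open>fps_inv \<phi>\<close>. Exchanging the two triangular sums
  separates these stages.\<close>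

lemma sum_recip_coeff:
  assumes "a \<in> fps_F1" "\<phi> \<in> fps_Fstar"
  shows "(\<Sum>k\<le>n. recip_coeff a \<phi> n k * taylor_at_0 h k) =
    taylor_at_0 ((h * inverse a) oo fps_inv \<phi>) n"
proof -
  let ?t = "\<lambda>k j. fact n * fps_nth (fps_inv \<phi> ^ j) n * (fps_nth h k * fps_nth (inverse a) (j - k))"
  have "(\<Sum>k\<le>n. recip_coeff a \<phi> n k * taylor_at_0 h k) = (\<Sum>k\<le>n. \<Sum>j=k..n. ?t k j)"
    unfolding recip_coeff_def reval_recip_R[OF assms(1)] reval_bell_A[OF assms(2)] sum_distrib_right
    by (intro sum.cong) (simp_all add: taylor_at_0_eq binomial_fact)
  also have "\<dots> = (\<Sum>k\<le>n. \<Sum>j\<in>{j\<in>{..n}. k \<le> j}. ?t k j)"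
    by (intro sum.cong) auto
  also have "\<dots> = (\<Sum>j\<le>n. \<Sum>k\<in>{k\<in>{..n}. k \<le> j}. ?t k j)"
    by (rule sum.swap_restrict) auto
  also have "\<dots> = (\<Sum>j\<le>n. \<Sum>k=0..j. ?t k j)"
    by (intro sum.cong) auto
  also have "\<dots> = taylor_at_0 ((h * inverse a) oo fps_inv \<phi>) n"
    by (simp add: taylor_at_0_eq fps_compose_nth fps_mult_nth[of h] sum_distrib_left sum_distrib_right
        mult_ac atMost_atLeast0)
  finally show ?thesis .
qed

text \<open>
  In the case \<open>a \<in> \<F>\<^sup>*\<close> the series \<open>h / a\<close> is computed as \<open>(h / x) / (a / x)\<close>, which explains the
  index shift.
\<close>

definition Gamma_bar_coeff :: "'a::field_char_0 fps \<Rightarrow> 'a fps \<Rightarrow> nat \<Rightarrow> nat \<Rightarrow> 'a" where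
  "Gamma_bar_coeff a \<phi> n k = (if a \<in> fps_F1 then recip_coeff a \<phi> n k
     else if k = 0 then 0 else recip_coeff (fps_shift 1 a) \<phi> n (k - 1) / of_nat k)"

definition fps_quot :: "'a::field_char_0 fps \<Rightarrow> 'a fps \<Rightarrow> 'a fps" where
  "fps_quot h a = (if a \<in> fps_F1 then h * inverse a else fps_shift 1 h * inverse (fps_shift 1 a))"

lemma mult_fps_quot:
  assumes "a \<in> fps_F1 \<union> fps_Fstar" "a \<in> fps_F1 \<or> fps_nth h 0 = 0"
  shows "a * fps_quot h a = h"
proof (cases "a \<in> fps_F1")
  case True
  then have "a * inverse a = 1" by (simp add: fps_F1_def inverse_mult_eq_1')
  with True show ?thesis by (simp add: fps_quot_def mult.left_commute[of a])
next
  case False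
  then have a: "fps_nth a 0 = 0" "fps_nth (fps_shift 1 a) 0 \<noteq> 0" and h: "fps_nth h 0 = 0"
    using assms by (auto simp: fps_Fstar_iff)
  have X: "g = fps_shift 1 g * fps_X" if "fps_nth g 0 = 0" for g :: "'a fps"
    using that by (auto simp: fps_eq_iff)
  have "a * fps_quot h a = (fps_shift 1 a * inverse (fps_shift 1 a)) * (fps_shift 1 h * fps_X)"
    using False by (subst X[OF a(1)]) (simp add: fps_quot_def mult_ac)
  also have "\<dots> = h" using X[OF h] inverse_mult_eq_1'[OF a(2)] by simp
  finally show ?thesis .
qed

lemma taylor_at_0_fps_shift:
  "taylor_at_0 (fps_shift (Suc 0) g) = (\<lambda>i. taylor_at_0 g (Suc i) / (1 + of_nat i))"
  for g :: "'a::field_char_0 fps"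
proof
  fix i
  have "(1 + of_nat i :: 'a) \<noteq> 0" by (metis of_nat_Suc of_nat_neq_0)
  then show "taylor_at_0 (fps_shift (Suc 0) g) i = taylor_at_0 g (Suc i) / (1 + of_nat i)"
    by (simp add: taylor_at_0_eq field_simps)
qed

text \<open>The bound \<open>Suc n\<close> covers both versions. For \<open>a\<close> in
  \<open>fps_F1\<close> the last coefficient is an empty sum; otherwise the indices are shifted by
  one and the coefficient of \<open>X\<^sub>0\<close> is zero.\<close>

lemma Gamma_bar_poly_eq:
  "Gamma_bar_poly a \<phi> n = (\<Sum>k\<le>Suc n. rconst (Gamma_bar_coeff a \<phi> n k) * rvar k)"
proof (cases "a \<in> fps_F1")
  case True
  then show ?thesis
    by (simp add: Gamma_bar_poly_def Gamma_bar_poly1_def Gamma_bar_coeff_def recip_coeff_def rsubst.emb_0)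
next
  case False
  have "Gamma_bar_poly2 a \<phi> n =
      (\<Sum>k\<le>n. rconst (Gamma_bar_coeff a \<phi> n (Suc k)) * rvar (Suc k))"
    unfolding Gamma_bar_poly2_def using False
    by (intro sum.cong) (simp_all add: Gamma_bar_coeff_def recip_coeff_def
        taylor_at_0_fps_shift)
  with False show ?thesis
    by (simp add: Gamma_bar_poly_def sum.atMost_Suc_shift Gamma_bar_coeff_def rsubst.emb_0 del: sum.atMost_Suc)
qed

lemma Gamma_bar_coeff_eq_0: "Suc n < k \<Longrightarrow> Gamma_bar_coeff a \<phi> n k = 0"
  by (simp add: Gamma_bar_coeff_def recip_coeff_def)

lemma sum_Gamma_bar_coeff:
  assumes "a \<in> fps_F1 \<union> fps_Fstar" "\<phi> \<in> fps_Fstar" "fps_nth h 0 = 0"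
  shows "(\<Sum>k\<le>Suc n. Gamma_bar_coeff a \<phi> n k * taylor_at_0 h k) =
    taylor_at_0 (fps_quot h a oo fps_inv \<phi>) n"
proof (cases "a \<in> fps_F1")
  case True
  have "recip_coeff a \<phi> n (Suc n) = 0" by (simp add: recip_coeff_def)
  with True sum_recip_coeff[OF True assms(2), of n h] show ?thesis
    by (simp add: Gamma_bar_coeff_def fps_quot_def)
next
  case False
  then have F1: "fps_shift 1 a \<in> fps_F1" using assms(1) by (auto simp: fps_Fstar_iff fps_F1_def)
  \<comment> \<open>After the index shift, the factor \<open>1 / (k + 1)\<close> is exactly what
    turns Taylor coefficient \<open>k + 1\<close> of \<open>h\<close> into Taylor coefficient
    \<open>k\<close> of \<open>h / x\<close>.\<close>
  have "(\<Sum>k\<le>Suc n. Gamma_bar_coeff a \<phi> n k * taylor_at_0 h k) =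
      (\<Sum>k\<le>n. recip_coeff (fps_shift 1 a) \<phi> n k * taylor_at_0 (fps_shift 1 h) k)"
    using False
    by (simp add: sum.atMost_Suc_shift Gamma_bar_coeff_def taylor_at_0_fps_shift
        del: sum.atMost_Suc)
  with False show ?thesis
    unfolding sum_recip_coeff[OF F1 assms(2)] by (simp only: fps_quot_def if_False)
qed

lemma fps_compose_inv_right:
  assumes "\<phi> \<in> fps_Fstar"
  shows "(g oo \<phi>) oo fps_inv \<phi> = g"
  using assms fps_compose_assoc[of "fps_inv \<phi>" \<phi> g] fps_inv_right[of \<phi>]
  by (simp add: fps_Fstar_iff fps_inv_def)

lemma fps_compose_inv_left:
  assumes "\<phi> \<in> fps_Fstar"
  shows "(g oo fps_inv \<phi>) oo \<phi> = g"
  using assms fps_compose_assoc[of \<phi> "fps_inv \<phi>" g] fps_inv[of \<phi>]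
  by (simp add: fps_Fstar_iff fps_inv_def)

lemma fps_inv_in_fps_Fstar: "g \<in> fps_Fstar \<Longrightarrow> fps_inv g \<in> fps_Fstar"
  by (simp add: fps_Fstar_iff fps_inv_def)

text \<open>Column \<open>j\<close> of the second matrix is the image of \<open>x^j / j!\<close>,
  and multiplying by \<open>a\<close> after composing with \<open>\<phi>\<close> restores that
  series. With \<open>j \<ge> 1\<close> it is divisible by \<open>x\<close>, as the quotient
  requires for \<open>a\<close> in \<open>fps_Fstar\<close>.\<close>

lemma Gamma_coeff_Gamma_bar_coeff:
  assumes "a \<in> fps_F1 \<union> fps_Fstar" "\<phi> \<in> fps_Fstar" "j \<ge> 1"
  shows "(\<Sum>k\<le>n. Gamma_coeff a \<phi> n k * Gamma_bar_coeff a \<phi> k j) = (if n = j then 1 else 0)"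
proof -
  let ?h = "egf (\<lambda>k. if k = j then 1 else 0) :: 'a fps"
  have h0: "fps_nth ?h 0 = 0" using assms(3) by simp
  have "Gamma_bar_coeff a \<phi> k j = taylor_at_0 (fps_quot ?h a oo fps_inv \<phi>) k" for k
  proof -
    have "(\<Sum>i\<le>Suc k. Gamma_bar_coeff a \<phi> k i * taylor_at_0 ?h i) =
        (\<Sum>i\<in>{..Suc k}. if i = j then Gamma_bar_coeff a \<phi> k i else 0)"
      by (intro sum.cong) auto
    also have "\<dots> = Gamma_bar_coeff a \<phi> k j"
      using Gamma_bar_coeff_eq_0[of k j a \<phi>] by (auto simp del: sum.atMost_Suc)
    finally show ?thesis
      using sum_Gamma_bar_coeff[OF assms(1,2) h0, of k] by simp
  qed
  then have "(\<Sum>k\<le>n. Gamma_coeff a \<phi> n k * Gamma_bar_coeff a \<phi> k j) =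
      taylor_at_0 (a * ((fps_quot ?h a oo fps_inv \<phi>) oo \<phi>)) n"
    using sum_Gamma_coeff[OF assms(2), of a n "taylor_at_0 (fps_quot ?h a oo fps_inv \<phi>)"] by simp
  also have "\<dots> = taylor_at_0 ?h n"
    unfolding fps_compose_inv_left[OF assms(2)] using mult_fps_quot[OF assms(1), of ?h] h0 by simp
  finally show ?thesis by simp
qed

lemma sum_Gamma_bar_coeff_mult_compose:
  assumes "a \<in> fps_F1 \<union> fps_Fstar" "\<phi> \<in> fps_Fstar" "fps_nth (a * (g oo \<phi>)) 0 = 0"
  shows "(\<Sum>k\<le>Suc n. Gamma_bar_coeff a \<phi> n k * taylor_at_0 (a * (g oo \<phi>)) k) = taylor_at_0 g n"
proof -
  have "a * fps_quot (a * (g oo \<phi>)) a = a * (g oo \<phi>)"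
    using assms by (intro mult_fps_quot) auto
  moreover have "a \<noteq> 0" using assms(1) by (auto simp: fps_F1_def fps_Fstar_iff)
  ultimately have "fps_quot (a * (g oo \<phi>)) a = g oo \<phi>" by simp
  then show ?thesis
    unfolding sum_Gamma_bar_coeff[OF assms] by (simp add: fps_compose_inv_right assms(2))
qed

text \<open>The opposite product is likewise tested on \<open>x^j / j!\<close>. The condition on
  \<open>j\<close> and \<open>a\<close> makes \<open>a * (\<phi>^j / j!)\<close> vanish at
  0.\<close>

lemma Gamma_bar_coeff_Gamma_coeff:
  assumes "a \<in> fps_F1 \<union> fps_Fstar" "\<phi> \<in> fps_Fstar" "j \<ge> 1 \<or> a \<in> fps_Fstar"
  shows "(\<Sum>k\<le>Suc n. Gamma_bar_coeff a \<phi> n k * Gamma_coeff a \<phi> k j) = (if n = j then 1 else 0)"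
proof -
  let ?g = "egf (\<lambda>k. if k = j then 1 else 0) :: 'a fps"
  have "fps_nth (a * (?g oo \<phi>)) 0 = 0" using assms(3) by (auto simp: fps_Fstar_iff)
  moreover have "Gamma_coeff a \<phi> k j = taylor_at_0 (a * (?g oo \<phi>)) k" for k
  proof -
    have "(\<Sum>i\<le>k. Gamma_coeff a \<phi> k i * (if i = j then 1 else 0)) =
        (\<Sum>i\<in>{..k}. if i = j then Gamma_coeff a \<phi> k i else 0)"
      by (intro sum.cong) auto
    also have "\<dots> = Gamma_coeff a \<phi> k j"
      using Gamma_coeff_eq_0[OF assms(2), of k j a] by auto
    finally have "(\<Sum>i\<le>k. Gamma_coeff a \<phi> k i * (if i = j then 1 else 0)) = Gamma_coeff a \<phi> k j" .
    then show ?thesis using sum_Gamma_coeff[OF assms(2)] by metis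
  qed
  ultimately show ?thesis
    using sum_Gamma_bar_coeff_mult_compose[OF assms(1,2)] by (simp del: sum.atMost_Suc)
qed

section \<open>The polynomials \<open>\<Lambda>\<^sub>n\<close>\<close>

context char_0_embedding
begin

text \<open>Resetting index 0 reflects the substitution \<open>X\<^sub>0 := 0\<close> of version
  (1).\<close>

definition Gamma_seq :: "'a fps \<Rightarrow> 'a fps \<Rightarrow> (nat \<Rightarrow> 'b) \<Rightarrow> nat \<Rightarrow> 'b" where
  "Gamma_seq a \<phi> v n = (\<Sum>k\<le>n. \<iota> (Gamma_coeff a \<phi> n k) * (if a \<in> fps_F1 then v(0 := 0) else v) k)"

definition Gamma_bar_seq :: "'a fps \<Rightarrow> 'a fps \<Rightarrow> (nat \<Rightarrow> 'b) \<Rightarrow> nat \<Rightarrow> 'b" where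
  "Gamma_bar_seq a \<phi> y n = (\<Sum>k\<le>Suc n. \<iota> (Gamma_bar_coeff a \<phi> n k) * y k)"

lemma insert_linear_form:
  "defined_at v (\<Sum>k\<le>n. rconst (c k) * rvar k)"
  "ratfun_insert \<iota> v (\<Sum>k\<le>n. rconst (c k) * rvar k) = (\<Sum>k\<le>n. \<iota> (c k) * v k)"
  by (simp_all add: insert_sum insert_mult insert_rconst insert_rvar)

lemma insert_Gamma_poly:
  assumes "\<phi> \<in> fps_Fstar"
  shows "defined_at v (Gamma_poly a \<phi> n)" "ratfun_insert \<iota> v (Gamma_poly a \<phi> n) = Gamma_seq a \<phi> v n"
proof -
  let ?X = "\<lambda>j. if j = 0 then 0 else rvar j :: 'a ratfun"
  have X: "defined_at v (?X j)" "ratfun_insert \<iota> v (?X j) = (v(0 := 0)) j" for j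
    by (simp_all add: insert_0 insert_rvar)
  show "defined_at v (Gamma_poly a \<phi> n)" "ratfun_insert \<iota> v (Gamma_poly a \<phi> n) = Gamma_seq a \<phi> v n"
    unfolding Gamma_poly_def Gamma_poly1_def Gamma_poly2_def Gamma_poly_gen_eq[OF assms] Gamma_seq_def
    using insert_rsubst[of v ?X, OF X(1) insert_linear_form(1)]
    by (simp_all only: X(2) insert_linear_form split: if_split) simp_all
qed

text \<open>The nonvanishing assumption is what makes \<open>bell_A j 1\<close> defined at the
  values of \<Gamma>. For \<open>k = 1\<close>, \<open>insert_bell_A\<close> yields the Taylor
  coefficients of the inverse series itself.\<close>

lemma insert_Lambda_poly:
  assumes "\<phi> \<in> fps_Fstar" "Gamma_seq a \<phi> v 1 \<noteq> 0"
  shows "ratfun_insert \<iota> v (Lambda_poly a \<phi> b \<psi> n) =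
    Gamma_bar_seq b \<psi> (taylor_at_0 (fps_inv (egf ((Gamma_seq a \<phi> v)(0 := 0))))) n"
proof -
  let ?u = "Gamma_seq a \<phi> v"
  have A: "defined_at v (bell_A j 1 \<circ>\<^sub>R Gamma_poly a \<phi>)"
    "ratfun_insert \<iota> v (bell_A j 1 \<circ>\<^sub>R Gamma_poly a \<phi>) = taylor_at_0 (fps_inv (egf (?u(0 := 0)))) j" for j
    using insert_rsubst[of v "Gamma_poly a \<phi>" "bell_A j 1"] insert_bell_A[of ?u j 1] assms(2)
    by (simp_all add: insert_Gamma_poly[OF assms(1)] taylor_at_0_eq)
  show ?thesis
    unfolding Lambda_poly_def Gamma_bar_poly_eq Gamma_bar_seq_def
    using insert_rsubst(2)[of v "\<lambda>j. bell_A j 1 \<circ>\<^sub>R Gamma_poly a \<phi>", OF A(1) insert_linear_form(1)]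
    by (simp only: A(2) insert_linear_form)
qed

lemma Gamma_seq_0: "a \<in> fps_F1 \<union> fps_Fstar \<Longrightarrow> Gamma_seq a \<phi> v 0 = 0"
  by (auto simp: Gamma_seq_def Gamma_coeff_def fps_Fstar_iff emb_0)

text \<open>The matrix identity over the base field is carried over by the embedding and applied to
  a sequence in the larger field. Column 0, which the identity does not cover, is multiplied by
  \<open>y 0 = 0\<close>.\<close>

lemma Gamma_seq_Gamma_bar_seq:
  assumes "a \<in> fps_F1 \<union> fps_Fstar" "\<phi> \<in> fps_Fstar" "y 0 = 0"
  shows "Gamma_seq a \<phi> (Gamma_bar_seq a \<phi> y) = y"
proof
  fix n
  let ?w = "Gamma_bar_seq a \<phi> y"
  \<comment> \<open>In version (1) the entry at index 0 is a multiple of \<open>y 0\<close>, so the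
    reset inside \<open>Gamma_seq\<close> changes nothing.\<close>
  have "?w 0 = 0" if "a \<in> fps_F1"
    using that assms(3) by (simp add: Gamma_bar_seq_def Gamma_bar_coeff_def recip_coeff_def emb_0)
  then have "(if a \<in> fps_F1 then ?w(0 := 0) else ?w) = ?w"
    by (simp add: fun_upd_idem)
  then have "Gamma_seq a \<phi> ?w n = (\<Sum>k\<le>n. \<iota> (Gamma_coeff a \<phi> n k) * ?w k)"
    by (simp add: Gamma_seq_def)
  \<comment> \<open>All inner sums are extended to the common bound \<open>Suc n\<close>, with
    vanishing coefficients, so that the order of summation can be exchanged.\<close>
  also have "\<dots> = (\<Sum>k\<le>n. \<iota> (Gamma_coeff a \<phi> n k) * (\<Sum>j\<le>Suc n. \<iota> (Gamma_bar_coeff a \<phi> k j) * y j))"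
    unfolding Gamma_bar_seq_def
    by (intro sum.cong refl arg_cong2[of _ _ _ _ "(*)"] sum.mono_neutral_left)
      (auto simp: Gamma_bar_coeff_eq_0 emb_0)
  also have "\<dots> = (\<Sum>j\<le>Suc n. \<Sum>k\<le>n. \<iota> (Gamma_coeff a \<phi> n k * Gamma_bar_coeff a \<phi> k j) * y j)"
    unfolding sum_distrib_left by (subst sum.swap) (simp only: emb_mult mult.assoc)
  also have "\<dots> = (\<Sum>j\<le>Suc n. \<iota> (\<Sum>k\<le>n. Gamma_coeff a \<phi> n k * Gamma_bar_coeff a \<phi> k j) * y j)"
    by (simp only: emb_sum sum_distrib_right)
  also have "\<dots> = (\<Sum>j\<in>{..Suc n}. if j = n then y j else 0)"
  proof (rule sum.cong[OF refl])
    fix j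
    show "\<iota> (\<Sum>k\<le>n. Gamma_coeff a \<phi> n k * Gamma_bar_coeff a \<phi> k j) * y j = (if j = n then y j else 0)"
      using assms(3) Gamma_coeff_Gamma_bar_coeff[OF assms(1,2), of j n]
      by (cases "j = 0") (simp_all add: emb_0 emb_1)
  qed
  also have "\<dots> = y n" by (simp del: sum.atMost_Suc)
  finally show "Gamma_seq a \<phi> ?w n = y n" .
qed

text \<open>For \<open>a\<close> in \<open>fps_F1\<close> the entry at index 0 is lost. This is why
  the final identity between rational functions is stated for \<open>n \<ge> 1\<close>.\<close>

lemma Gamma_bar_seq_Gamma_seq:
  assumes "a \<in> fps_F1 \<union> fps_Fstar" "\<phi> \<in> fps_Fstar"
  shows "Gamma_bar_seq a \<phi> (Gamma_seq a \<phi> v) n = (if a \<in> fps_F1 then v(0 := 0) else v) n"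
proof -
  define v' where "v' = (if a \<in> fps_F1 then v(0 := 0) else v)"
  have "Gamma_bar_seq a \<phi> (Gamma_seq a \<phi> v) n =
      (\<Sum>k\<le>Suc n. \<iota> (Gamma_bar_coeff a \<phi> n k) * (\<Sum>j\<le>Suc n. \<iota> (Gamma_coeff a \<phi> k j) * v' j))"
    unfolding Gamma_bar_seq_def Gamma_seq_def v'_def[symmetric]
    by (intro sum.cong refl arg_cong2[of _ _ _ _ "(*)"] sum.mono_neutral_left)
      (auto simp: Gamma_coeff_eq_0[OF assms(2)] emb_0)
  also have "\<dots> = (\<Sum>j\<le>Suc n. \<Sum>k\<le>Suc n. \<iota> (Gamma_bar_coeff a \<phi> n k * Gamma_coeff a \<phi> k j) * v' j)"
    unfolding sum_distrib_left by (subst sum.swap) (simp only: emb_mult mult.assoc)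
  also have "\<dots> = (\<Sum>j\<le>Suc n. \<iota> (\<Sum>k\<le>Suc n. Gamma_bar_coeff a \<phi> n k * Gamma_coeff a \<phi> k j) * v' j)"
    by (simp only: emb_sum sum_distrib_right)
  also have "\<dots> = (\<Sum>j\<in>{..Suc n}. if j = n then v' j else 0)"
  proof (rule sum.cong[OF refl])
    fix j
    show "\<iota> (\<Sum>k\<le>Suc n. Gamma_bar_coeff a \<phi> n k * Gamma_coeff a \<phi> k j) * v' j =
        (if j = n then v' j else 0)"
    proof (cases "j \<ge> 1 \<or> a \<in> fps_Fstar")
      case True
      show ?thesis
        unfolding Gamma_bar_coeff_Gamma_coeff[OF assms True] by (simp add: emb_0 emb_1)
    next
      case False
      then have "v' j = 0" using assms(1) by (auto simp: v'_def not_le)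
      then show ?thesis by auto
    qed
  qed
  also have "\<dots> = v' n" by (simp del: sum.atMost_Suc)
  finally show ?thesis by (simp only: v'_def)
qed

end

section \<open>Expansions in \<open>a * \<phi> ^ n\<close> and the inversion formulas\<close>

text \<open>Each coefficient of the partial sums is eventually constant, since
  \<open>\<phi> ^ k\<close> contributes nothing below degree \<open>k\<close>. Convergence thus
  becomes an equation between series.\<close>

lemma sums_mult_compose_iff:
  fixes a \<phi> f :: "'a::field_char_0 fps"
  assumes "\<phi> \<in> fps_Fstar"
  shows "(\<lambda>n. fps_const (c n / fact n) * a * \<phi> ^ n) sums f \<longleftrightarrow> f = a * (egf c oo \<phi>)"
proof -
  let ?s = "\<lambda>n. fps_const (c n / fact n) * a * \<phi> ^ n"
  have nth: "fps_nth (?s k) n = Gamma_coeff a \<phi> n k * c k / fact n" for n k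
    by (simp add: Gamma_coeff_def mult.assoc)
  have "fps_nth (sum ?s {..<N}) n = fps_nth (a * (egf c oo \<phi>)) n" if "N > n" for N n
  proof -
    have "fps_nth (sum ?s {..<N}) n = (\<Sum>k<N. Gamma_coeff a \<phi> n k * c k / fact n)"
      by (simp add: fps_sum_nth nth)
    also have "\<dots> = (\<Sum>k\<le>n. Gamma_coeff a \<phi> n k * c k / fact n)"
      using that by (intro sum.mono_neutral_right) (auto simp: Gamma_coeff_eq_0[OF assms])
    also have "\<dots> = fps_nth (a * (egf c oo \<phi>)) n"
      by (simp add: sum_Gamma_coeff[OF assms] taylor_at_0_eq flip: sum_divide_distrib)
    finally show ?thesis .
  qed
  then have "?s sums (a * (egf c oo \<phi>))"
    unfolding sums_def
    by (intro tendsto_fpsI eventually_mono[OF eventually_gt_at_top])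
  then show ?thesis by (auto dest: sums_unique2)
qed

lemma mult_compose_expansion_ex1:
  fixes a \<phi> f :: "'a::field_char_0 fps"
  assumes "f \<in> fps_Fstar" "\<phi> \<in> fps_Fstar" "a \<in> fps_F1 \<union> fps_Fstar"
  shows "\<exists>!c. (\<lambda>n. fps_const (c n / fact n) * a * \<phi> ^ n) sums f"
  unfolding sums_mult_compose_iff[OF assms(2)]
proof (rule ex_ex1I)
  \<comment> \<open>Solving \<open>f = a * (C oo \<phi>)\<close> for \<open>C\<close> gives
    \<open>(f / a)\<close> composed with the inverse of \<open>\<phi>\<close>.\<close>
  let ?c = "taylor_at_0 (fps_quot f a oo fps_inv \<phi>)"
  have "f = a * (egf ?c oo \<phi>)"
    using assms mult_fps_quot[of a f] by (simp add: fps_compose_inv_left fps_Fstar_iff)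
  then show "\<exists>c. f = a * (egf c oo \<phi>)" by (rule exI[of _ ?c])
next
  fix c c' assume "f = a * (egf c oo \<phi>)" "f = a * (egf c' oo \<phi>)"
  moreover have "a \<noteq> 0" using assms(3) by (auto simp: fps_F1_def fps_Fstar_iff)
  ultimately have "egf c oo \<phi> = egf c' oo \<phi>" by simp
  then have "egf c = egf c'" using fps_compose_inv_right[OF assms(2)] by metis
  then show "c = c'" by (metis taylor_at_0_egf)
qed

text \<open>For \<open>a\<close> in \<open>fps_F1\<close> a vanishing constant term of the product
  forces \<open>c 0 = 0\<close>, so the reset at index 0 is harmless.\<close>

lemma Gamma_seq_eq_taylor:
  assumes "\<phi> \<in> fps_Fstar" "a \<in> fps_F1 \<union> fps_Fstar" "fps_nth (a * (egf c oo \<phi>)) 0 = 0"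
  shows "reval_0.Gamma_seq a \<phi> c = taylor_at_0 (a * (egf c oo \<phi>))"
    and "(if a \<in> fps_F1 then c(0 := 0) else c) = c"
proof -
  show *: "(if a \<in> fps_F1 then c(0 := 0) else c) = c"
    using assms(3) by (auto simp: fps_F1_def fun_upd_idem)
  show "reval_0.Gamma_seq a \<phi> c = taylor_at_0 (a * (egf c oo \<phi>))"
    unfolding reval_0.Gamma_seq_def[abs_def] * by (simp add: sum_Gamma_coeff[OF assms(1)])
qed

text \<open>The three stages of \<Lambda> send \<open>c\<close> to the Taylor coefficients of
  \<open>f\<close>, these to those of \<open>fps_inv f\<close>, and these to
  \<open>d\<close>.\<close>

lemma reval_Lambda_poly:
  assumes "f \<in> fps_Fstar" "\<phi> \<in> fps_Fstar" "\<psi> \<in> fps_Fstar"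
    and "a \<in> fps_F1 \<union> fps_Fstar" "b \<in> fps_F1 \<union> fps_Fstar"
    and "f = a * (egf c oo \<phi>)" "fps_inv f = b * (egf d oo \<psi>)"
  shows "reval (Lambda_poly a \<phi> b \<psi> n) c = d n"
proof -
  have f: "fps_nth f 0 = 0" "fps_nth f 1 \<noteq> 0" "fps_nth (fps_inv f) 0 = 0"
    using assms(1) by (simp_all add: fps_Fstar_iff fps_inv_def)
  have c: "reval_0.Gamma_seq a \<phi> c = taylor_at_0 f"
    using Gamma_seq_eq_taylor(1)[OF assms(2,4)] f(1) unfolding assms(6) by blast
  have d: "reval_0.Gamma_seq b \<psi> d = taylor_at_0 (fps_inv f)" "(if b \<in> fps_F1 then d(0 := 0) else d) = d"
    using Gamma_seq_eq_taylor[OF assms(3,5), of d] f(3) unfolding assms(7) by blast+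
  have "reval (Lambda_poly a \<phi> b \<psi> n) c =
      reval_0.Gamma_bar_seq b \<psi> (taylor_at_0 (fps_inv (egf ((taylor_at_0 f)(0 := 0))))) n"
    unfolding reval_def using f(2)
    by (subst reval_0.insert_Lambda_poly) (simp_all add: assms(2) c taylor_at_0_eq)
  also have "\<dots> = d n"
    unfolding egf_taylor_at_0_upd[OF f(1)] d(1)[symmetric]
      reval_0.Gamma_bar_seq_Gamma_seq[OF assms(5,3)] d(2) ..
  finally show ?thesis .
qed

text \<open>At the generic point the linear form is
  \<open>b\<^sub>0 \<psi>\<^sub>1 X\<^sub>1\<close> for \<open>b\<close> in \<open>fps_F1\<close>
  and \<open>b\<^sub>1 X\<^sub>0\<close> for \<open>b\<close> in \<open>fps_Fstar\<close>, where the
  subscripts denote Taylor coefficients.\<close>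

lemma Gamma_seq_rvar_1_nonzero:
  assumes "b \<in> fps_F1 \<union> fps_Fstar" "\<psi> \<in> fps_Fstar"
  shows "rsubst_0.Gamma_seq b \<psi> rvar 1 \<noteq> 0"
proof -
  have rconst: "rconst x \<noteq> 0" if "x \<noteq> 0" for x :: 'a
    using that by (simp add: rconst_def Zero_fract_def eq_fract single_eq_0_iff)
  show ?thesis
    using assms by (auto simp: rsubst_0.Gamma_seq_def Gamma_coeff_def fps_F1_def fps_Fstar_iff
        fps_mult_nth rvar_nonzero rsubst.emb_0 intro!: rconst)
qed

lemma Lambda_poly_involution:
  assumes "\<phi> \<in> fps_Fstar" "\<psi> \<in> fps_Fstar"
    and "a \<in> fps_F1 \<union> fps_Fstar" "b \<in> fps_F1 \<union> fps_Fstar" "n \<ge> 1"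
  shows "Lambda_poly a \<phi> b \<psi> n \<circ>\<^sub>R Lambda_poly b \<psi> a \<phi> = rvar n"
proof -
  let ?u = "rsubst_0.Gamma_seq b \<psi> rvar"
  let ?w = "Lambda_poly b \<psi> a \<phi>"
  \<comment> \<open>\<open>G\<close> is a series over the field of rational functions, with the
    polynomials \<open>Gamma_poly b \<psi>\<close> as Taylor coefficients.\<close>
  define G where "G = egf (?u(0 := 0))"
  have G: "G \<in> fps_Fstar"
    using Gamma_seq_rvar_1_nonzero[OF assms(4,2)] by (simp add: G_def fps_Fstar_iff)
  have u: "?u = taylor_at_0 G"
    using rsubst_0.Gamma_seq_0[OF assms(4), of \<psi> rvar] by (simp add: G_def fun_upd_idem)
  have "?w = rsubst_0.Gamma_bar_seq a \<phi> (taylor_at_0 (fps_inv G))"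
    using rsubst_0.insert_Lambda_poly[OF assms(2) Gamma_seq_rvar_1_nonzero[OF assms(4,2)]]
    by (simp add: fun_eq_iff G_def flip: rsubst_def) (simp add: rsubst_rvar)
  moreover have inv: "fps_inv G \<in> fps_Fstar" by (rule fps_inv_in_fps_Fstar[OF G])
  \<comment> \<open>The inner \<Gamma>-bar and the outer \<Gamma>, both for \<open>a\<close> and
    \<open>\<phi>\<close>, cancel. What remains is to invert \<open>fps_inv G\<close> and to undo
    \<Gamma> for \<open>b\<close> and \<open>\<psi>\<close>.\<close>
  ultimately have w: "rsubst_0.Gamma_seq a \<phi> ?w = taylor_at_0 (fps_inv G)"
    using rsubst_0.Gamma_seq_Gamma_bar_seq[OF assms(3,1)] by (simp add: fps_Fstar_iff taylor_at_0_eq)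
  have "rsubst_0.Gamma_seq a \<phi> ?w 1 \<noteq> 0"
    unfolding w using inv by (simp add: taylor_at_0_eq fps_Fstar_iff)
  then have "Lambda_poly a \<phi> b \<psi> n \<circ>\<^sub>R ?w =
      rsubst_0.Gamma_bar_seq b \<psi> (taylor_at_0 (fps_inv (egf ((taylor_at_0 (fps_inv G))(0 := 0))))) n"
    unfolding rsubst_def using rsubst_0.insert_Lambda_poly[OF assms(1)] w by metis
  also have "\<dots> = rsubst_0.Gamma_bar_seq b \<psi> ?u n"
    using G inv by (simp add: egf_taylor_at_0_upd fps_Fstar_iff fps_inv_idempotent u)
  also have "\<dots> = rvar n"
    unfolding rsubst_0.Gamma_bar_seq_Gamma_seq[OF assms(4,2)] using assms(5) by simp
  finally show ?thesis .
qed

theorem theorem7p9: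
  fixes f \<phi> \<psi> a b :: "'a::field_char_0 fps"
  assumes "f \<in> fps_Fstar" and "\<phi> \<in> fps_Fstar" and "\<psi> \<in> fps_Fstar"
    and "a \<in> fps_F1 \<union> fps_Fstar" and "b \<in> fps_F1 \<union> fps_Fstar"
  shows "(\<exists>!c::nat \<Rightarrow> 'a. (\<lambda>n. fps_const (c n / fact n) * a * \<phi> ^ n) sums f) \<and>
         (\<exists>!d::nat \<Rightarrow> 'a. (\<lambda>n. fps_const (d n / fact n) * b * \<psi> ^ n) sums fps_inv f) \<and>
         (\<forall>c d. (\<lambda>n. fps_const (c n / fact n) * a * \<phi> ^ n) sums f \<longrightarrow>
                (\<lambda>n. fps_const (d n / fact n) * b * \<psi> ^ n) sums fps_inv f \<longrightarrow>
                (\<forall>n. d n = reval (Lambda_poly a \<phi> b \<psi> n) c \<and>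
                     c n = reval (Lambda_poly b \<psi> a \<phi> n) d)) \<and>
         (\<forall>n\<ge>1. Lambda_poly a \<phi> b \<psi> n \<circ>\<^sub>R Lambda_poly b \<psi> a \<phi> = rvar n)"
proof -
  \<comment> \<open>Since inversion is an involution on \<open>fps_Fstar\<close>, the formula for
    \<open>c\<close> is the one for \<open>d\<close> applied to \<open>fps_inv f\<close> with the
    two pairs exchanged.\<close>
  have inv: "fps_inv f \<in> fps_Fstar" "fps_inv (fps_inv f) = f"
    using assms(1) by (simp_all add: fps_inv_in_fps_Fstar) (simp add: fps_Fstar_iff fps_inv_idempotent)
  have "d n = reval (Lambda_poly a \<phi> b \<psi> n) c \<and> c n = reval (Lambda_poly b \<psi> a \<phi> n) d"
    if "f = a * (egf c oo \<phi>)" "fps_inv f = b * (egf d oo \<psi>)" for c d n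
  proof
    show "d n = reval (Lambda_poly a \<phi> b \<psi> n) c"
      using reval_Lambda_poly[OF assms that] ..
    have "fps_inv (fps_inv f) = a * (egf c oo \<phi>)"
      unfolding inv(2) by (rule that(1))
    from reval_Lambda_poly[OF inv(1) assms(3,2,5,4) that(2) this]
    show "c n = reval (Lambda_poly b \<psi> a \<phi> n) d" ..
  qed
  then show ?thesis
    using mult_compose_expansion_ex1[OF assms(1,2,4)] mult_compose_expansion_ex1[OF inv(1) assms(3,5)]
      Lambda_poly_involution[OF assms(2-5)]
    unfolding sums_mult_compose_iff[OF assms(2)] sums_mult_compose_iff[OF assms(3)] by blast
qed

end
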